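(* Let $n\ge 1$ be an integer and $\omega>0$. Assume that for each $i=1,\dots,n$ the functions $a_i,b_i:\mathbb{R}\to[0,\infty)$ are continuous and $\omega$-periodic with $\int_0^\omega a_i(t)\,dt>0$ and $\int_0^\omega b_i(t)\,dt>0$, and that $f_i:\mathbb{R}_+^n\setminus\{0\}\to(0,\infty)$ is continuous. For a parameter $\lambda>0$ consider the system $$x_i'(t)=-a_i(t)x_i(t)+\lambda b_i(t)f_i(x_1(t),\dots,x_n(t)),\qquad i=1,\dots,n. \quad (\ast)$$ Assume that $\lim_{\|\mathbf{u}\|\to 0}f_i(\mathbf{u})=\infty$ for some $i\in\{1,\dots,n\}$. Then: (a) If $\lim_{\|\mathbf{u}\|\to\infty}\frac{f_i(\mathbf{u})}{\|\mathbf{u}\|}=0$ for all $i=1,\dots,n$, then for all $\lambda>0$ the system $(\ast)$ has a positive $\omega$-periodic solution. (b) If $\lim_{\|\mathbf{u}\|\to\infty}\frac{f_i(\mathbf{u})}{\|\mathbf{u}\|}=\infty$ for all $i=1,\dots,n$, then for all sufficiently small $\lambda>0$ the system $(\ast)$ has two (distinct) positive $\omega$-periodic solutions. (c) There exists a $\lambda_0>0$ such that $(\ast)$ has a positive $\omega$-periodic solution for every $0<\lambda<\lambda_0$.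
   Context: $\mathbb{R}_+=[0,\infty)$, $\mathbb{R}_+^n=\prod_{i=1}^n\mathbb{R}_+$, and for $\mathbf{u}=(u_1,\dots,u_n)\in\mathbb{R}_+^n$, $\|\mathbf{u}\|=\sum_{i=1}^n|u_i|$. Limits are taken over $\mathbf{u}\in\mathbb{R}_+^n\setminus\{0\}$. A positive $\omega$-periodic solution is a differentiable $\omega$-periodic function $x=(x_1,\dots,x_n):\mathbb{R}\to\mathbb{R}^n$ with $x_i(t)>0$ for all $t\in\mathbb{R}$ and all $i$, satisfying the system for all $t\in\mathbb{R}$. *)

theory Defs
  imports "HOL-Analysis.Analysis" "HOL-Library.Periodic_Fun"
begin

definition punctured_orthant :: "(real ^ 'n) set" where
  "punctured_orthant = {u. \<forall>i. 0 \<le> u $ i} - {0}"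

(* The library norm on real ^ 'n is the Euclidean one, so the sum norm is introduced separately. *)
definition sum_norm :: "real ^ 'n \<Rightarrow> real" where
  "sum_norm u = (\<Sum>i\<in>UNIV. \<bar>u $ i\<bar>)"

(* The modes of convergence "sum_norm u \<rightarrow> 0" and "sum_norm u \<rightarrow> \<infinity>", with u ranging over the
   punctured orthant. *)
definition sum_norm_to_0 :: "(real ^ 'n) filter" where
  "sum_norm_to_0 = inf (filtercomap sum_norm (nhds 0)) (principal punctured_orthant)"

definition sum_norm_to_infinity :: "(real ^ 'n) filter" where
  "sum_norm_to_infinity = inf (filtercomap sum_norm at_top) (principal punctured_orthant)"

definition positive_periodic_solution ::
    "('n \<Rightarrow> real \<Rightarrow> real) \<Rightarrow> ('n \<Rightarrow> real \<Rightarrow> real) \<Rightarrow> ('n \<Rightarrow> real ^ 'n \<Rightarrow> real) \<Rightarrow> real \<Rightarrow> real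
      \<Rightarrow> (real \<Rightarrow> real ^ 'n) \<Rightarrow> bool" where
  "positive_periodic_solution a b f \<omega> lam x \<longleftrightarrow>
     periodic_fun_simple x \<omega> \<and>
     (\<forall>t i. 0 < x t $ i) \<and>
     (\<forall>t i. ((\<lambda>s. x s $ i) has_real_derivative
               (- a i t * x t $ i + lam * b i t * f i (x t))) (at t))"

end

theory Submission
  imports Defs "HOL-Complex_Analysis.Great_Picard"
begin

text \<open>
  Multiplying the \<open>i\<close>-th equation by the integrating factor \<open>exp (A i t)\<close>, where \<open>A i t\<close> is the
  integral of \<open>a i\<close> over \<open>[0, t]\<close>, turns the system into \<open>y' = lam * exp (A i t) * b i t * f i x\<close>
  for \<open>y = exp (A i t) * x\<close>. The right-hand side is nonnegative, so no component of \<open>y\<close> decreases, and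
  \<open>x\<close> differs from \<open>y\<close> by a factor between a constant \<open>\<sigma> > 0\<close> and 1 during one period. Hence a
  trajectory that starts with norm \<open>\<rho>\<close> keeps a norm of at least \<open>\<sigma> * \<rho>\<close> over one period: it stays away from the
  singularity at 0, and the limits of \<open>f i\<close> at 0 and at infinity give estimates for the map
  \<open>Q\<close> that sends \<open>x 0\<close> to \<open>x \<omega>\<close>:

  \<^item> if some \<open>f i\<close> tends to infinity at 0, then \<open>Q\<close> does not decrease the norm on small spheres;
  \<^item> if \<open>lam * f i\<close> is small compared with \<open>\<rho>\<close> on the shell from \<open>\<sigma> * \<rho>\<close> to \<open>2 * \<rho>\<close> for all \<open>i\<close>,
    then \<open>Q\<close> does not increase the norm on the sphere of radius \<open>\<rho>\<close>, since the damping over one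
    period strictly contracts; for given \<open>\<rho>\<close> this happens when \<open>lam\<close> is small, and for every \<open>lam\<close>
    when \<open>\<rho>\<close> is large and all \<open>f i\<close> are sublinear;
  \<^item> if some \<open>f i\<close> is superlinear, then \<open>Q\<close> does not decrease the norm on large spheres.

  On a shell between two spheres on which \<open>Q\<close> acts in opposite ways, a finite-dimensional
  form of Krasnoselskii's cone theorem (\<open>shell_fixed_point\<close>, from Brouwer's theorem in polar
  coordinates) gives a fixed point of \<open>Q\<close>. The first and second estimates give solutions for the
  sublinear case and for small \<open>lam\<close>, with \<open>sum_norm (x 0) \<le> 1\<close> in the latter; the second and third
  give another one with \<open>sum_norm (x 0) \<ge> 2\<close> for small \<open>lam\<close> in the superlinear case.

  As the \<open>f i\<close> are only continuous, solutions of initial value problems need not be unique, and for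
  superlinear \<open>f i\<close> they may blow up, so the map \<open>Q\<close> does not exist as such. It is replaced by its
  analogue for an Euler scheme with \<open>N\<close> steps, which is defined on the whole punctured orthant, is
  continuous, and satisfies the same estimates uniformly in \<open>N\<close>. The periodic Euler polygons
  obtained in this way are bounded and equicontinuous; a limit given by the Arzela-Ascoli theorem
  is a periodic solution (\<open>periodic_solution_of_polygons\<close>).
\<close>

section \<open>A fixed point theorem on a shell of the orthant\<close>

lemma sum_norm_nonneg: "0 \<le> sum_norm u"
  by (simp add: sum_norm_def sum_nonneg)

lemma component_le_sum_norm: "u $ i \<le> sum_norm u"
proof -
  have "\<bar>u $ i\<bar> \<le> sum_norm u"
    unfolding sum_norm_def by (rule member_le_sum) auto
  then show ?thesis by linarith
qed

lemma norm_le_sum_norm: "norm u \<le> sum_norm u"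
  unfolding sum_norm_def by (rule norm_le_l1_cart)

lemma sum_norm_eq_sum: "(\<And>i. 0 \<le> u $ i) \<Longrightarrow> sum_norm u = (\<Sum>i\<in>UNIV. u $ i)"
  by (simp add: sum_norm_def)

lemma sum_norm_mono:
  assumes "\<And>i. 0 \<le> u $ i" "\<And>i. u $ i \<le> v $ i"
  shows "sum_norm u \<le> sum_norm v"
  unfolding sum_norm_def by (rule sum_mono) (smt (verit) assms)

lemma sum_norm_scaleR: "0 \<le> c \<Longrightarrow> sum_norm (c *\<^sub>R u) = c * sum_norm u"
  by (simp add: sum_norm_def sum_distrib_left abs_mult)

lemma continuous_on_sum_norm: "continuous_on S sum_norm"
  unfolding sum_norm_def by (intro continuous_intros)

lemma punctured_orthant_nonneg: "u \<in> punctured_orthant \<Longrightarrow> 0 \<le> u $ i"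
  by (simp add: punctured_orthant_def)

lemma sum_norm_pos:
  assumes "u \<in> punctured_orthant"
  shows "0 < sum_norm u"
proof -
  have "0 < norm u"
    using assms by (auto simp: punctured_orthant_def)
  then show ?thesis
    using norm_le_sum_norm[of u] by linarith
qed

lemma punctured_orthantI:
  assumes "\<And>i. 0 \<le> u $ i" "0 < sum_norm u"
  shows "u \<in> punctured_orthant"
  using assms by (auto simp: punctured_orthant_def sum_norm_def)

definition shell :: "real \<Rightarrow> real \<Rightarrow> (real ^ 'n) set" where
  "shell r R = {u \<in> punctured_orthant. r \<le> sum_norm u \<and> sum_norm u \<le> R}"

lemma shell_alt:
  assumes "0 < r"
  shows "shell r R = {u. \<forall>i. 0 \<le> u $ i} \<inter> {u. r \<le> sum_norm u} \<inter> {u. sum_norm u \<le> R}"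
  using assms punctured_orthantI by (fastforce simp: shell_def punctured_orthant_def)

lemma compact_shell:
  assumes "0 < r"
  shows "compact (shell r R :: (real ^ 'n) set)"
proof -
  have "closed {u :: real ^ 'n. \<forall>i. 0 \<le> u $ i}"
    by (intro closed_Collect_all closed_Collect_le continuous_intros)
  moreover have "closed {u :: real ^ 'n. r \<le> sum_norm u}" "closed {u :: real ^ 'n. sum_norm u \<le> R}"
    by (intro closed_Collect_le continuous_intros continuous_on_sum_norm)+
  ultimately have "closed (shell r R :: (real ^ 'n) set)"
    using assms by (simp add: shell_alt closed_Int)
  moreover have "bounded (shell r R :: (real ^ 'n) set)"
    unfolding bounded_iff shell_def using norm_le_sum_norm order_trans by blast
  ultimately show ?thesis by (simp add: compact_eq_bounded_closed)
qed

text \<open>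
  In polar coordinates \<open>u = \<rho> \<theta>\<close>, with \<open>\<theta>\<close> in the standard simplex, the shell becomes the compact
  convex set \<open>simplex \<times> {r..R}\<close>, where Brouwer's theorem applies. The direction is sent to the
  direction of \<open>Q u\<close>, and the radius \<open>\<rho>\<close> is moved by \<open>s\<close> times the change of radius
  \<open>sum_norm (Q u) - \<rho>\<close> and then cut off to \<open>{r..R}\<close>. As only the vanishing of this change matters,
  its sign is free: \<open>s > 0\<close> covers maps that push both boundary spheres into the shell (compression)
  and \<open>s < 0\<close> those that push both out of it (expansion).
\<close>

theorem shell_fixed_point:
  fixes Q :: "real ^ 'n \<Rightarrow> real ^ 'n"
  assumes "0 < r" "r \<le> R" "s \<noteq> 0"
    and cont: "continuous_on (shell r R) Q"
    and Q: "\<And>u. u \<in> shell r R \<Longrightarrow> Q u \<in> punctured_orthant"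
    and inner: "\<And>u. u \<in> punctured_orthant \<Longrightarrow> sum_norm u = r \<Longrightarrow> 0 \<le> s * (sum_norm (Q u) - r)"
    and outer: "\<And>u. u \<in> punctured_orthant \<Longrightarrow> sum_norm u = R \<Longrightarrow> s * (sum_norm (Q u) - R) \<le> 0"
  obtains u where "u \<in> shell r R" "Q u = u"
proof -
  let ?\<Delta> = "{\<theta> :: real ^ 'n. (\<forall>i. 0 \<le> \<theta> $ i) \<and> (\<Sum>i\<in>UNIV. \<theta> $ i) = 1}"
  let ?S = "?\<Delta> \<times> {r..R}"
  define polar where "polar = (\<lambda>p :: (real ^ 'n) \<times> real. snd p *\<^sub>R fst p)"
  define \<Phi> where "\<Phi> = (\<lambda>p. ((1 / sum_norm (Q (polar p))) *\<^sub>R Q (polar p),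
    max r (min R (snd p + s * (sum_norm (Q (polar p)) - snd p)))))"
  have simplex: "sum_norm \<theta> = 1" if "\<theta> \<in> ?\<Delta>" for \<theta>
    using that by (simp add: sum_norm_eq_sum)
  have polar_norm: "sum_norm (polar p) = snd p" if "p \<in> ?S" for p
    using that simplex[of "fst p"] \<open>0 < r\<close> by (auto simp: polar_def sum_norm_scaleR)
  have polar_shell: "polar p \<in> shell r R" if "p \<in> ?S" for p
  proof -
    have "0 \<le> polar p $ i" for i
      using that \<open>0 < r\<close> by (auto simp: polar_def)
    then show ?thesis
      using polar_norm[OF that] that \<open>0 < r\<close> by (auto simp: shell_alt)
  qed
  have "closed ?\<Delta>"
    by (intro closed_Collect_conj closed_Collect_all closed_Collect_le closed_Collect_eq
        continuous_intros)
  moreover have "bounded ?\<Delta>"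
  proof (rule boundedI)
    show "norm \<theta> \<le> 1" if "\<theta> \<in> ?\<Delta>" for \<theta>
      using norm_le_sum_norm[of \<theta>] simplex[OF that] by simp
  qed
  ultimately have "compact ?\<Delta>"
    by (simp add: compact_eq_bounded_closed)
  then have "compact ?S"
    by (intro compact_Times compact_Icc)
  moreover have "convex ?\<Delta>"
    by (auto simp: convex_def sum.distrib sum_distrib_left[symmetric])
  then have "convex ?S"
    by (simp add: convex_Times)
  moreover have "axis undefined 1 \<in> ?\<Delta>"
    by (auto simp: axis_def)
  then have "?S \<noteq> {}"
    using \<open>r \<le> R\<close> by auto
  moreover have "continuous_on ?S \<Phi>"
  proof -
    have "continuous_on ?S (\<lambda>p. Q (polar p))"
    proof (rule continuous_on_compose2[OF cont])
      show "continuous_on ?S polar"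
        unfolding polar_def by (intro continuous_intros)
    qed (use polar_shell in blast)
    moreover have "sum_norm (Q (polar p)) \<noteq> 0" if "p \<in> ?S" for p
      using sum_norm_pos[OF Q[OF polar_shell[OF that]]] by simp
    ultimately show ?thesis
      unfolding \<Phi>_def
      by (intro continuous_intros continuous_on_compose2[OF continuous_on_sum_norm]) auto
  qed
  moreover have "\<Phi> \<in> ?S \<rightarrow> ?S"
  proof
    fix p assume "p \<in> ?S"
    then have q: "Q (polar p) \<in> punctured_orthant"
      using Q polar_shell by blast
    let ?\<theta> = "(1 / sum_norm (Q (polar p))) *\<^sub>R Q (polar p)"
    have nn: "0 \<le> ?\<theta> $ i" for i
      using punctured_orthant_nonneg[OF q, of i] sum_norm_nonneg[of "Q (polar p)"] by simp
    moreover have "sum_norm ?\<theta> = 1"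
      using sum_norm_pos[OF q] by (subst sum_norm_scaleR) auto
    ultimately have "?\<theta> \<in> ?\<Delta>"
      using sum_norm_eq_sum[of ?\<theta>] by simp
    moreover have "snd (\<Phi> p) \<in> {r..R}"
      using \<open>r \<le> R\<close> by (auto simp: \<Phi>_def)
    ultimately show "\<Phi> p \<in> ?S"
      by (simp add: \<Phi>_def)
  qed
  ultimately obtain p where p: "p \<in> ?S" "\<Phi> p = p"
    by (rule brouwer)
  define d where "d = sum_norm (Q (polar p)) - snd p"
  have bounds: "r \<le> snd p" "snd p \<le> R"
    using p by auto
  have clamp: "max r (min R (snd p + s * d)) = snd p"
    using arg_cong[OF p(2), of snd] by (simp add: \<Phi>_def d_def)
  have po: "polar p \<in> punctured_orthant"
    using polar_shell[OF p(1)] by (simp add: shell_def)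
  have "snd p = r \<Longrightarrow> 0 \<le> s * d" "snd p = R \<Longrightarrow> s * d \<le> 0"
    using inner[OF po] outer[OF po] polar_norm[OF p(1)] by (auto simp: d_def)
  \<comment> \<open>The cut-off can act only at \<open>r\<close> or \<open>R\<close>, where the boundary hypotheses give \<open>s * d\<close> the opposite sign.\<close>
  then have "s * d = 0"
    using clamp bounds by (auto simp: max_def min_def split: if_splits)
  then have eq: "sum_norm (Q (polar p)) = snd p"
    using \<open>s \<noteq> 0\<close> by (simp add: d_def)
  have dir: "fst p = (1 / snd p) *\<^sub>R Q (polar p)"
    using arg_cong[OF p(2), of fst] by (simp add: \<Phi>_def eq)
  have "polar p = snd p *\<^sub>R ((1 / snd p) *\<^sub>R Q (polar p))"
    by (subst dir[symmetric]) (rule polar_def[THEN fun_cong])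
  then have "polar p = Q (polar p)"
    using bounds \<open>0 < r\<close> by simp
  then show ?thesis
    using that[of "polar p"] polar_shell[OF p(1)] by simp
qed

section \<open>The integrating factor\<close>

locale periodic_coefficients =
  fixes a b :: "'n::finite \<Rightarrow> real \<Rightarrow> real" and \<omega> :: real
  assumes period_pos: "0 < \<omega>"
    and continuous_a: "\<And>i. continuous_on UNIV (a i)"
    and continuous_b: "\<And>i. continuous_on UNIV (b i)"
    and a_nonneg: "\<And>i t. 0 \<le> a i t"
    and b_nonneg: "\<And>i t. 0 \<le> b i t"
    and a_periodic: "\<And>i. periodic_fun_simple (a i) \<omega>"
    and b_periodic: "\<And>i. periodic_fun_simple (b i) \<omega>"
    and a_mass: "\<And>i. 0 < integral {0..\<omega>} (a i)"
    and b_mass: "\<And>i. 0 < integral {0..\<omega>} (b i)"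
begin

definition A :: "'n \<Rightarrow> real \<Rightarrow> real" where
  "A i t = integral {0..t} (a i)"

text \<open>
  For \<open>y i t = exp (A i t) * x i t\<close> the equation with nonlinearity \<open>F i\<close> says that \<open>y i\<close> is an integral
  of \<open>F i (x t)\<close> with respect to \<open>dC i\<close>. As \<open>C i\<close> is nondecreasing, so is \<open>y i\<close> when \<open>F i\<close> is positive.
\<close>

definition C :: "'n \<Rightarrow> real \<Rightarrow> real" where
  "C i t = integral {0..t} (\<lambda>s. exp (A i s) * b i s)"

definition damp :: "real \<Rightarrow> real ^ 'n \<Rightarrow> real ^ 'n" where
  "damp t y = (\<chi> i. exp (- A i t) * y $ i)"

text \<open>
  The strongest and the weakest damping over one period, and the total growth per period for a
  nonlinearity that is constantly 1.
\<close>

definition \<sigma> :: real where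
  "\<sigma> = Min (range (\<lambda>i. exp (- A i \<omega>)))"

definition \<theta> :: real where
  "\<theta> = Max (range (\<lambda>i. exp (- A i \<omega>)))"

definition \<Gamma> :: real where
  "\<Gamma> = (\<Sum>i\<in>UNIV. C i \<omega>)"

lemma continuous_on_a: "continuous_on S (a i)"
  using continuous_a continuous_on_subset by blast

lemma continuous_on_b: "continuous_on S (b i)"
  using continuous_b continuous_on_subset by blast

lemma A_0 [simp]: "A i 0 = 0"
  by (simp add: A_def)

lemma A_mono:
  assumes "0 \<le> s" "s \<le> t"
  shows "A i s \<le> A i t"
  unfolding A_def
  by (rule integral_subset_le)
    (use assms a_nonneg in \<open>auto intro!: integrable_continuous_interval continuous_on_a\<close>)

lemma A_deriv:
  "t \<in> {0..\<omega>} \<Longrightarrow> (A i has_real_derivative a i t) (at t within {0..\<omega>})"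
  unfolding A_def by (rule integral_has_real_derivative[OF continuous_on_a])

lemma continuous_on_A: "continuous_on {0..\<omega>} (A i)"
  using A_deriv by (intro DERIV_continuous_on)

lemma continuous_on_C_integrand:
  "t \<le> \<omega> \<Longrightarrow> continuous_on {0..t} (\<lambda>s. exp (A i s) * b i s)"
  by (intro continuous_intros continuous_on_b continuous_on_subset[OF continuous_on_A]) auto

lemma C_0 [simp]: "C i 0 = 0"
  by (simp add: C_def)

lemma C_mono:
  assumes "0 \<le> s" "s \<le> t" "t \<le> \<omega>"
  shows "C i s \<le> C i t"
  unfolding C_def
  by (rule integral_subset_le)
    (use assms b_nonneg in \<open>auto intro!: integrable_continuous_interval continuous_on_C_integrand\<close>)

lemma C_nonneg: "0 \<le> t \<Longrightarrow> t \<le> \<omega> \<Longrightarrow> 0 \<le> C i t"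
  using C_mono[of 0 t i] by simp

lemma C_deriv:
  "t \<in> {0..\<omega>} \<Longrightarrow> (C i has_real_derivative exp (A i t) * b i t) (at t within {0..\<omega>})"
  unfolding C_def by (rule integral_has_real_derivative) (simp_all add: continuous_on_C_integrand)

lemma continuous_on_C: "continuous_on {0..\<omega>} (C i)"
  using C_deriv by (intro DERIV_continuous_on)

lemma C_period_pos: "0 < C i \<omega>"
proof -
  have "integral {0..\<omega>} (b i) \<le> C i \<omega>"
    unfolding C_def
  proof (rule integral_le)
    show "b i s \<le> exp (A i s) * b i s" if "s \<in> {0..\<omega>}" for s
      using that A_mono[of 0 s i] b_nonneg[of i s] by (simp add: mult_le_cancel_right1)
  qed (auto intro!: integrable_continuous_interval continuous_on_C_integrand continuous_on_b)
  then show ?thesis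
    using b_mass[of i] by linarith
qed

lemma \<sigma>_le: "\<sigma> \<le> exp (- A i \<omega>)"
  unfolding \<sigma>_def by (rule Min_le) auto

lemma \<theta>_ge: "exp (- A i \<omega>) \<le> \<theta>"
  unfolding \<theta>_def by (rule Max_ge) auto

lemma \<sigma>_pos: "0 < \<sigma>"
  unfolding \<sigma>_def by (subst Min_gr_iff) auto

lemma \<sigma>_le_1: "\<sigma> \<le> 1"
  using \<sigma>_le[of undefined] A_mono[of 0 \<omega> undefined] period_pos
  by (smt (verit) A_0 exp_le_one_iff)

lemma \<theta>_less_1: "\<theta> < 1"
  unfolding \<theta>_def by (subst Max_less_iff) (use a_mass in \<open>auto simp: A_def\<close>)

lemma \<Gamma>_pos: "0 < \<Gamma>"
  unfolding \<Gamma>_def by (rule sum_pos) (auto simp: C_period_pos)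

text \<open>
  Over a whole period the factors \<open>exp (- A i t)\<close> stay between \<open>\<sigma>\<close> and 1. This comparison of
  \<open>x = damp t y\<close> with the monotone \<open>y\<close> plays the part of a cone condition: the norm of \<open>x\<close> cannot drop
  below \<open>\<sigma>\<close> times any earlier value within the period.
\<close>

lemma damp_bounds:
  assumes "t \<in> {0..\<omega>}" "\<And>i. 0 \<le> y $ i"
  shows "\<sigma> * y $ i \<le> damp t y $ i" and "damp t y $ i \<le> y $ i"
proof -
  have "\<sigma> \<le> exp (- A i t)"
    using \<sigma>_le[of i] A_mono[of t \<omega> i] assms(1) by (smt (verit) atLeastAtMost_iff exp_le_cancel_iff)
  then show "\<sigma> * y $ i \<le> damp t y $ i"
    using assms(2)[of i] by (simp add: damp_def mult_right_mono)
  have "exp (- A i t) \<le> 1"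
    using A_mono[of 0 t i] assms(1) by simp
  then show "damp t y $ i \<le> y $ i"
    using assms(2)[of i] by (simp add: damp_def mult_left_le_one_le)
qed

lemma damp_sum_norm_bounds:
  assumes "t \<in> {0..\<omega>}" "\<And>i. 0 \<le> y $ i"
  shows "\<sigma> * sum_norm y \<le> sum_norm (damp t y)" and "sum_norm (damp t y) \<le> sum_norm y"
proof -
  have "sum_norm (\<sigma> *\<^sub>R y) \<le> sum_norm (damp t y)"
    using damp_bounds(1)[OF assms] assms(2) \<sigma>_pos by (intro sum_norm_mono) auto
  then show "\<sigma> * sum_norm y \<le> sum_norm (damp t y)"
    using \<sigma>_pos by (simp add: sum_norm_scaleR)
  show "sum_norm (damp t y) \<le> sum_norm y"
    using damp_bounds(2)[OF assms] assms(2) by (intro sum_norm_mono) (auto simp: damp_def)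
qed

lemma damp_punctured_orthant:
  assumes "t \<in> {0..\<omega>}" "y \<in> punctured_orthant"
  shows "damp t y \<in> punctured_orthant"
proof (rule punctured_orthantI)
  have nn: "0 \<le> y $ i" for i
    using assms(2) by (rule punctured_orthant_nonneg)
  then show "0 \<le> damp t y $ i" for i
    by (simp add: damp_def)
  have "0 < \<sigma> * sum_norm y"
    using \<sigma>_pos sum_norm_pos[OF assms(2)] by simp
  then show "0 < sum_norm (damp t y)"
    using damp_sum_norm_bounds(1)[OF assms(1) nn] by linarith
qed

end

section \<open>The discrete Poincare map\<close>

text \<open>
  The criteria for existence are proved without a parameter and then applied to \<open>lam * g i\<close> in place
  of \<open>g i\<close>. The constants above depend only on the coefficients, so they are the same for all \<open>lam\<close>.
\<close>

locale periodic_system = periodic_coefficients a b \<omega>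
  for a b :: "'n::finite \<Rightarrow> real \<Rightarrow> real" and \<omega> :: real +
  fixes g :: "'n \<Rightarrow> real ^ 'n \<Rightarrow> real"
  assumes continuous_g: "\<And>i. continuous_on punctured_orthant (g i)"
    and g_pos: "\<And>i u. u \<in> punctured_orthant \<Longrightarrow> 0 < g i u"
begin

definition node :: "nat \<Rightarrow> nat \<Rightarrow> real" where
  "node N j = \<omega> * real j / real N"

text \<open>
  The scheme advances \<open>y\<close> and not \<open>x\<close>: on each step only the argument of \<open>g\<close> is kept constant, and
  the resulting linear equation is solved exactly. Thus \<open>a\<close> and \<open>b\<close> enter through exact integrals, and
  the estimates below hold for every number of steps.
\<close>

primrec euler :: "nat \<Rightarrow> real ^ 'n \<Rightarrow> nat \<Rightarrow> real ^ 'n" where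
  "euler N v 0 = v"
| "euler N v (Suc j) = (\<chi> i. euler N v j $ i +
     (C i (node N (Suc j)) - C i (node N j)) * g i (damp (node N j) (euler N v j)))"

definition state :: "nat \<Rightarrow> real ^ 'n \<Rightarrow> nat \<Rightarrow> real ^ 'n" where
  "state N v j = damp (node N j) (euler N v j)"

definition poincare :: "nat \<Rightarrow> real ^ 'n \<Rightarrow> real ^ 'n" where
  "poincare N v = state N v N"

lemma node_0 [simp]: "node N 0 = 0"
  by (simp add: node_def)

lemma node_mono: "j \<le> l \<Longrightarrow> node N j \<le> node N l"
  using period_pos by (simp add: node_def divide_right_mono)

lemma node_nonneg: "0 \<le> node N j"
  using node_mono[of 0 j N] by simp

lemma node_last [simp]: "0 < N \<Longrightarrow> node N N = \<omega>"
  by (simp add: node_def)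

lemma node_le: "j \<le> N \<Longrightarrow> node N j \<le> \<omega>"
  using node_mono[of j N N] period_pos by (cases "N = 0") (auto simp: node_def)

lemma node_Suc: "node N (Suc j) = node N j + \<omega> / real N"
  by (simp add: node_def add_divide_distrib ring_distribs)

lemma C_node_mono: "j \<le> l \<Longrightarrow> l \<le> N \<Longrightarrow> C i (node N j) \<le> C i (node N l)"
  by (intro C_mono node_mono node_nonneg node_le)

lemma euler_Suc_component:
  "euler N v (Suc j) $ i =
     euler N v j $ i + (C i (node N (Suc j)) - C i (node N j)) * g i (state N v j)"
  by (simp add: state_def)

lemma euler_step:
  assumes "v \<in> punctured_orthant" "j \<le> N"
  shows "euler N v j \<in> punctured_orthant \<and> (\<forall>i. v $ i \<le> euler N v j $ i)"
  using assms(2)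
proof (induction j)
  case 0
  then show ?case
    using assms(1) by simp
next
  case (Suc j)
  then have y: "euler N v j \<in> punctured_orthant" "\<And>i. v $ i \<le> euler N v j $ i"
    by auto
  have "state N v j \<in> punctured_orthant"
    unfolding state_def using y(1) Suc.prems node_le[of j N] node_nonneg
    by (intro damp_punctured_orthant) auto
  then have "0 < g i (state N v j)" for i
    by (rule g_pos)
  then have "0 \<le> (C i (node N (Suc j)) - C i (node N j)) * g i (state N v j)" for i
    using C_node_mono[of j "Suc j" N i] Suc.prems by (simp add: less_imp_le)
  then have le: "v $ i \<le> euler N v (Suc j) $ i" for i
    unfolding euler_Suc_component using y(2)[of i] add_increasing2 by blast
  have "euler N v (Suc j) \<in> punctured_orthant"
  proof (rule punctured_orthantI)
    show "0 \<le> euler N v (Suc j) $ i" for i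
      using le[of i] punctured_orthant_nonneg[OF assms(1), of i] by linarith
    show "0 < sum_norm (euler N v (Suc j))"
      using sum_norm_mono[OF punctured_orthant_nonneg[OF assms(1)] le] sum_norm_pos[OF assms(1)]
      by linarith
  qed
  with le show ?case
    by blast
qed

lemma euler_punctured_orthant:
  "v \<in> punctured_orthant \<Longrightarrow> j \<le> N \<Longrightarrow> euler N v j \<in> punctured_orthant"
  using euler_step by blast

lemma state_punctured_orthant:
  "v \<in> punctured_orthant \<Longrightarrow> j \<le> N \<Longrightarrow> state N v j \<in> punctured_orthant"
  unfolding state_def
  by (intro damp_punctured_orthant euler_punctured_orthant) (auto simp: node_nonneg node_le)

lemma euler_mono:
  assumes "v \<in> punctured_orthant" "j \<le> l" "l \<le> N"
  shows "euler N v j $ i \<le> euler N v l $ i"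
  using assms(2,3)
proof (induction l rule: dec_induct)
  case (step l)
  have "0 < g i (state N v l)"
    using step.prems assms(1) by (intro g_pos state_punctured_orthant) auto
  moreover have "C i (node N l) \<le> C i (node N (Suc l))"
    using step.prems by (intro C_node_mono) auto
  ultimately have "euler N v l $ i \<le> euler N v (Suc l) $ i"
    by (simp only: euler_Suc_component) simp
  with step show ?case
    by simp
qed simp

lemma state_bounds:
  assumes "v \<in> punctured_orthant" "j \<le> N"
  shows "\<sigma> * sum_norm (euler N v j) \<le> sum_norm (state N v j)"
    and "sum_norm (state N v j) \<le> sum_norm (euler N v j)"
  unfolding state_def
  using punctured_orthant_nonneg[OF euler_punctured_orthant[OF assms]] assms(2)
  by (auto intro!: damp_sum_norm_bounds simp: node_nonneg node_le)

lemma euler_sum_norm_mono: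
  assumes "v \<in> punctured_orthant" "j \<le> l" "l \<le> N"
  shows "sum_norm (euler N v j) \<le> sum_norm (euler N v l)"
  using assms
  by (intro sum_norm_mono euler_mono punctured_orthant_nonneg[OF euler_punctured_orthant]) auto

text \<open>
  A trajectory cannot come close to the singularity: \<open>y\<close> does not decrease, and \<open>x\<close> is at least \<open>\<sigma> * y\<close>.
\<close>

lemma state_lower_bound:
  assumes "v \<in> punctured_orthant" "j \<le> N"
  shows "\<sigma> * sum_norm v \<le> sum_norm (state N v j)"
proof -
  have "\<sigma> * sum_norm v \<le> \<sigma> * sum_norm (euler N v j)"
    using euler_sum_norm_mono[of v 0 j N] assms \<sigma>_pos by simp
  then show ?thesis
    using state_bounds(1)[OF assms] by linarith
qed

lemma continuous_on_euler:
  "j \<le> N \<Longrightarrow> continuous_on punctured_orthant (\<lambda>v. euler N v j)"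
proof (induction j)
  case (Suc j)
  then have IH: "continuous_on punctured_orthant (\<lambda>v. euler N v j)"
    by simp
  then have "continuous_on punctured_orthant (\<lambda>v. state N v j)"
    unfolding state_def damp_def by (intro continuous_intros)
  then have "continuous_on punctured_orthant (\<lambda>v. g i (state N v j))" for i
    by (rule continuous_on_compose2[OF continuous_g])
      (use Suc.prems state_punctured_orthant in auto)
  with IH show ?case
    unfolding euler.simps state_def[symmetric] by (intro continuous_intros)
qed simp

lemma continuous_on_poincare: "continuous_on punctured_orthant (poincare N)"
  unfolding poincare_def [abs_def] state_def damp_def
  by (intro continuous_intros continuous_on_euler order_refl)

text \<open>
  The increments of \<open>C i\<close> telescope, so a bound on \<open>g i\<close> along the discrete trajectory is a bound
  on the growth of the \<open>i\<close>-th component, whatever the number of steps.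
\<close>

lemma euler_upper:
  assumes "\<And>l. l < j \<Longrightarrow> g i (state N v l) \<le> m" "j \<le> N"
  shows "euler N v j $ i \<le> v $ i + m * C i (node N j)"
  using assms
proof (induction j)
  case (Suc j)
  have "(C i (node N (Suc j)) - C i (node N j)) * g i (state N v j)
      \<le> (C i (node N (Suc j)) - C i (node N j)) * m"
    using Suc.prems C_node_mono[of j "Suc j" N i] by (intro mult_left_mono) auto
  then show ?case
    using Suc by (simp only: euler_Suc_component) (simp add: algebra_simps)
qed simp

lemma euler_lower:
  assumes "\<And>l. l < j \<Longrightarrow> m \<le> g i (state N v l)" "j \<le> N"
  shows "v $ i + m * C i (node N j) \<le> euler N v j $ i"
  using assms
proof (induction j)
  case (Suc j)
  have "(C i (node N (Suc j)) - C i (node N j)) * m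
      \<le> (C i (node N (Suc j)) - C i (node N j)) * g i (state N v j)"
    using Suc.prems C_node_mono[of j "Suc j" N i] by (intro mult_left_mono) auto
  then show ?case
    using Suc by (simp only: euler_Suc_component) (simp add: algebra_simps)
qed simp

end

section \<open>Derivatives of limits and periodic continuations\<close>

text \<open>
  The chain rule for a derivative \<open>G\<close> of \<open>Y\<close> with respect to \<open>C\<close>. The increments of \<open>C\<close> may vanish, so
  this derivative is expressed without quotients.
\<close>

lemma has_real_derivative_relative_increments:
  fixes Y C :: "real \<Rightarrow> real"
  assumes C: "(C has_real_derivative c) (at t\<^sub>0 within S)"
    and Y: "\<And>e. 0 < e \<Longrightarrow> \<exists>d>0. \<forall>t\<in>S. \<bar>t - t\<^sub>0\<bar> < d \<longrightarrow>
      \<bar>Y t - Y t\<^sub>0 - G * (C t - C t\<^sub>0)\<bar> \<le> e * \<bar>C t - C t\<^sub>0\<bar>"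
  shows "(Y has_real_derivative G * c) (at t\<^sub>0 within S)"
proof -
  let ?qC = "\<lambda>t. (C t - C t\<^sub>0) / (t - t\<^sub>0)"
  let ?qY = "\<lambda>t. (Y t - Y t\<^sub>0) / (t - t\<^sub>0)"
  have C': "(?qC \<longlongrightarrow> c) (at t\<^sub>0 within S)"
    using C by (simp add: has_field_derivative_iff)
  have "((\<lambda>t. ?qY t - G * ?qC t) \<longlongrightarrow> 0) (at t\<^sub>0 within S)"
  proof (rule tendstoI)
    fix e :: real assume "0 < e"
    define e' where "e' = e / 2 / (\<bar>c\<bar> + 1)"
    have "\<bar>c\<bar> + 1 \<noteq> 0"
      by linarith
    then have e': "e' * (\<bar>c\<bar> + 1) = e / 2"
      by (rule iffD1[OF nonzero_eq_divide_eq e'_def])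
    have "0 < e'"
      using \<open>0 < e\<close> by (simp add: e'_def add_nonneg_pos)
    then obtain d where d: "0 < d" "\<And>t. t \<in> S \<Longrightarrow> \<bar>t - t\<^sub>0\<bar> < d \<Longrightarrow>
        \<bar>Y t - Y t\<^sub>0 - G * (C t - C t\<^sub>0)\<bar> \<le> e' * \<bar>C t - C t\<^sub>0\<bar>"
      using Y by blast
    have "eventually (\<lambda>t. dist (?qC t) c < 1) (at t\<^sub>0 within S)"
      using C' by (rule tendstoD) simp
    moreover have "eventually (\<lambda>t. t \<in> S \<and> t \<noteq> t\<^sub>0 \<and> \<bar>t - t\<^sub>0\<bar> < d) (at t\<^sub>0 within S)"
      unfolding eventually_at using d(1) by (auto simp: dist_real_def)
    ultimately show "eventually (\<lambda>t. dist (?qY t - G * ?qC t) 0 < e) (at t\<^sub>0 within S)"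
    proof eventually_elim
      case (elim t)
      then have qC: "\<bar>?qC t\<bar> \<le> \<bar>c\<bar> + 1"
        unfolding dist_real_def by linarith
      have "?qY t - G * ?qC t = (Y t - Y t\<^sub>0 - G * (C t - C t\<^sub>0)) / (t - t\<^sub>0)"
        by (simp add: diff_divide_distrib right_diff_distrib)
      moreover have "\<bar>Y t - Y t\<^sub>0 - G * (C t - C t\<^sub>0)\<bar> / \<bar>t - t\<^sub>0\<bar> \<le> e' * \<bar>C t - C t\<^sub>0\<bar> / \<bar>t - t\<^sub>0\<bar>"
        using d(2)[of t] elim by (intro divide_right_mono) auto
      ultimately have le: "\<bar>?qY t - G * ?qC t\<bar> \<le> e' * \<bar>?qC t\<bar>"
        by (simp only: abs_divide times_divide_eq_right)
      have "e' * \<bar>?qC t\<bar> \<le> e' * (\<bar>c\<bar> + 1)"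
        using mult_left_mono[OF qC less_imp_le[OF \<open>0 < e'\<close>]] .
      with le have "\<bar>?qY t - G * ?qC t\<bar> \<le> e' * (\<bar>c\<bar> + 1)"
        by (rule order_trans)
      also have "e' * (\<bar>c\<bar> + 1) < e"
        unfolding e' using \<open>0 < e\<close> by simp
      finally have "\<bar>?qY t - G * ?qC t\<bar> < e" .
      then show ?case
        by (simp only: dist_real_def diff_0_right)
    qed
  qed
  then have "((\<lambda>t. (?qY t - G * ?qC t) + G * ?qC t) \<longlongrightarrow> 0 + G * c) (at t\<^sub>0 within S)"
    by (intro tendsto_add tendsto_mult tendsto_const C')
  then show ?thesis
    by (simp add: has_field_derivative_iff)
qed

definition wrap :: "real \<Rightarrow> real \<Rightarrow> real" where
  "wrap \<omega> t = t - of_int \<lfloor>t / \<omega>\<rfloor> * \<omega>"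

lemma wrap_bounds:
  assumes "0 < \<omega>"
  shows "0 \<le> wrap \<omega> t" "wrap \<omega> t < \<omega>"
proof -
  define k where "k = \<lfloor>t / \<omega>\<rfloor>"
  have "of_int k \<le> t / \<omega>" "t / \<omega> < of_int k + 1"
    unfolding k_def by linarith+
  then show "0 \<le> wrap \<omega> t" "wrap \<omega> t < \<omega>"
    using assms by (simp_all add: wrap_def k_def[symmetric] pos_le_divide_eq pos_divide_less_eq
        algebra_simps)
qed

lemma wrap_add_period:
  assumes "0 < \<omega>"
  shows "wrap \<omega> (t + \<omega>) = wrap \<omega> t"
proof -
  have "(t + \<omega>) / \<omega> = t / \<omega> + 1"
    using assms by (simp add: add_divide_distrib)
  then show ?thesis
    by (simp add: wrap_def algebra_simps)
qed

lemma wrap_eq: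
  assumes "0 < \<omega>" "of_int k * \<omega> \<le> t" "t < of_int k * \<omega> + \<omega>"
  shows "wrap \<omega> t = t - of_int k * \<omega>"
proof -
  have "\<lfloor>t / \<omega>\<rfloor> = k"
    using assms by (intro floor_unique) (simp_all add: field_simps)
  then show ?thesis
    by (simp add: wrap_def)
qed

lemma periodic_wrap:
  assumes "periodic_fun_simple f \<omega>"
  shows "f (wrap \<omega> t) = f t"
proof -
  interpret periodic_fun_simple f \<omega>
    by (rule assms)
  show ?thesis
    unfolding wrap_def by (rule minus_of_int)
qed

text \<open>
  At a multiple of \<open>\<omega>\<close> the two one-sided derivatives come from the two ends of the interval, and
  they agree because \<open>x\<close> and \<open>d\<close> take the same value at both ends.
\<close>

lemma has_real_derivative_wrap:
  fixes x d :: "real \<Rightarrow> real"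
  assumes "0 < \<omega>" "x \<omega> = x 0" "d \<omega> = d 0"
    and deriv: "\<And>t. t \<in> {0..\<omega>} \<Longrightarrow> (x has_real_derivative d t) (at t within {0..\<omega>})"
  shows "((\<lambda>s. x (wrap \<omega> s)) has_real_derivative d (wrap \<omega> t)) (at t)"
proof -
  let ?I = "\<lambda>k :: int. {of_int k * \<omega>..of_int k * \<omega> + \<omega>}"
  have eq: "z (wrap \<omega> s) = z (s - of_int k * \<omega>)" if "s \<in> ?I k" "z \<omega> = z 0" for z :: "real \<Rightarrow> real" and s k
  proof (cases "s = of_int k * \<omega> + \<omega>")
    case True
    then have "wrap \<omega> s = s - of_int (k + 1) * \<omega>"
      using assms(1) by (intro wrap_eq) (auto simp: algebra_simps)
    then show ?thesis
      using True that(2) by (simp add: algebra_simps)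
  next
    case False
    then show ?thesis
      using wrap_eq[of \<omega> k s] that assms(1) by auto
  qed
  have within: "((\<lambda>s. x (wrap \<omega> s)) has_real_derivative d (wrap \<omega> t)) (at t within ?I k)"
    if t: "t \<in> ?I k" for k
  proof (rule has_field_derivative_transform_within[where d = 1])
    have img: "(\<lambda>s. s - of_int k * \<omega>) ` ?I k \<subseteq> {0..\<omega>}"
      by auto
    have "(x has_real_derivative d (t - of_int k * \<omega>))
        (at (t - of_int k * \<omega>) within (\<lambda>s. s - of_int k * \<omega>) ` ?I k)"
      using t by (intro has_field_derivative_subset[OF deriv img]) auto
    then have "(x \<circ> (\<lambda>s. s - of_int k * \<omega>) has_real_derivative d (t - of_int k * \<omega>) * 1)
        (at t within ?I k)"
      by (rule DERIV_image_chain) (auto intro!: derivative_eq_intros)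
    then show "((\<lambda>s. x (s - of_int k * \<omega>)) has_real_derivative d (wrap \<omega> t)) (at t within ?I k)"
      using eq[of t k d] t assms(3) by (simp add: o_def)
    show "x (s - of_int k * \<omega>) = x (wrap \<omega> s)" if "s \<in> ?I k" for s
      using eq[OF that assms(2)] by (rule sym)
  qed (use t in simp_all)
  define k where "k = \<lfloor>t / \<omega>\<rfloor>"
  have t: "of_int k * \<omega> \<le> t" "t < of_int k * \<omega> + \<omega>"
    using wrap_bounds[OF assms(1), of t] by (auto simp: wrap_def k_def)
  show ?thesis
  proof (cases "t = of_int k * \<omega>")
    case False
    then have "at t within ?I k = at t"
      using t by (intro at_within_Icc_at) auto
    then show ?thesis
      using within[of k] t by simp
  next
    case True
    have "?I (k - 1) \<union> ?I k = {of_int k * \<omega> - \<omega>..of_int k * \<omega> + \<omega>}"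
      using assms(1) by (auto simp: algebra_simps)
    then have full: "at t within (?I (k - 1) \<union> ?I k) = at t"
      using True assms(1) by (simp add: at_within_Icc_at)
    have "t \<in> ?I (k - 1)" "t \<in> ?I k"
      using True assms(1) by (auto simp: algebra_simps)
    then have "((\<lambda>s. x (wrap \<omega> s)) has_real_derivative d (wrap \<omega> t))
        (at t within (?I (k - 1) \<union> ?I k))"
      using within[of "k - 1"] within[of k]
      unfolding has_field_derivative_iff unfolding at_within_union
      by (intro filterlim_sup) blast+
    then show ?thesis
      unfolding full .
  qed
qed

section \<open>Euler polygons\<close>

context periodic_system
begin

definition clip :: "nat \<Rightarrow> nat \<Rightarrow> real \<Rightarrow> real" where
  "clip N l t = max (node N l) (min (node N (Suc l)) t)"

text \<open>
  On the step from \<open>node N l\<close> to \<open>node N (Suc l)\<close> the summand with index \<open>l\<close> is the only one that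
  changes with \<open>t\<close>: earlier ones have reached their final value, later ones are still 0.
\<close>

definition polygon :: "nat \<Rightarrow> real ^ 'n \<Rightarrow> real \<Rightarrow> real ^ 'n" where
  "polygon N v t = (\<chi> i. v $ i +
     (\<Sum>l<N. (C i (clip N l t) - C i (node N l)) * g i (state N v l)))"

lemma polygon_node:
  assumes "j \<le> N"
  shows "polygon N v (node N j) = euler N v j"
proof -
  have "euler N v j $ i =
      v $ i + (\<Sum>l<j. (C i (node N (Suc l)) - C i (node N l)) * g i (state N v l))" for i
    by (induction j) (simp_all only: euler_Suc_component euler.simps(1) sum.lessThan_Suc
        lessThan_0 sum.empty add_0_right add.assoc)
  moreover have "(\<Sum>l<N. (C i (clip N l (node N j)) - C i (node N l)) * g i (state N v l)) =
      (\<Sum>l<j. (C i (node N (Suc l)) - C i (node N l)) * g i (state N v l))" for i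
  proof (rule sum.mono_neutral_cong_right)
    show "\<forall>l\<in>{..<N} - {..<j}. (C i (clip N l (node N j)) - C i (node N l)) * g i (state N v l) = 0"
    proof
      fix l assume "l \<in> {..<N} - {..<j}"
      then have "clip N l (node N j) = node N l"
        using node_mono[of j l N] node_mono[of j "Suc l" N] by (auto simp: clip_def)
      then show "(C i (clip N l (node N j)) - C i (node N l)) * g i (state N v l) = 0"
        by simp
    qed
    fix l assume "l \<in> {..<j}"
    then have "clip N l (node N j) = node N (Suc l)"
      using node_mono[of "Suc l" j N] node_mono[of l "Suc l" N] by (auto simp: clip_def)
    then show "(C i (clip N l (node N j)) - C i (node N l)) * g i (state N v l) =
        (C i (node N (Suc l)) - C i (node N l)) * g i (state N v l)"
      by simp
  qed (use assms in auto)
  ultimately show ?thesis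
    by (simp add: polygon_def vec_eq_iff)
qed

lemma polygon_0 [simp]: "polygon N v 0 = v"
  using polygon_node[of 0 N v] by simp

lemma polygon_period: "0 < N \<Longrightarrow> polygon N v \<omega> = euler N v N"
  using polygon_node[of N N v] by simp

lemma clip_telescope:
  assumes "0 \<le> t"
  shows "(\<Sum>l<j. C i (clip N l t) - C i (node N l)) = C i (min t (node N j))"
proof (induction j)
  case 0
  then show ?case
    using assms by (simp add: min_def)
next
  case (Suc j)
  show ?case
    using node_mono[of j "Suc j" N] unfolding sum.lessThan_Suc Suc
    by (cases "t \<le> node N j") (auto simp: clip_def max_def min_def intro!: arg_cong[of _ _ "C i"])
qed

lemma clip_in_period: "l < N \<Longrightarrow> clip N l t \<in> {0..\<omega>}"
  using node_nonneg[of N l] node_le[of l N] node_le[of "Suc l" N] node_nonneg[of N "Suc l"]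
  by (auto simp: clip_def)

lemma clip_mono: "s \<le> t \<Longrightarrow> clip N l s \<le> clip N l t"
  by (auto simp: clip_def)

lemma C_clip_mono: "s \<le> t \<Longrightarrow> l < N \<Longrightarrow> C i (clip N l s) \<le> C i (clip N l t)"
  using clip_in_period[of l N s] clip_in_period[of l N t] by (intro C_mono clip_mono) auto

lemma polygon_mono:
  assumes "v \<in> punctured_orthant" "s \<le> t"
  shows "polygon N v s $ i \<le> polygon N v t $ i"
  using assms C_clip_mono less_imp_le[OF g_pos[OF state_punctured_orthant[OF assms(1)]]]
  by (auto simp: polygon_def intro!: sum_mono mult_right_mono diff_right_mono)

text \<open>
  Only the steps of the grid that meet \<open>[s, t]\<close> contribute to an increment. With \<open>G = 0\<close> this gives
  the equicontinuity of the polygons, and with \<open>G\<close> the value of \<open>g i\<close> at the limit it gives the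
  differential equation.
\<close>

lemma polygon_increment:
  assumes "0 < N" "0 \<le> s" "s \<le> t" "t \<le> \<omega>"
    and near: "\<And>l. l < N \<Longrightarrow> node N l \<le> t \<Longrightarrow> s \<le> node N (Suc l) \<Longrightarrow> \<bar>g i (state N v l) - G\<bar> \<le> e"
  shows "\<bar>polygon N v t $ i - polygon N v s $ i - G * (C i t - C i s)\<bar> \<le> e * (C i t - C i s)"
proof -
  define D where "D l = C i (clip N l t) - C i (clip N l s)" for l
  have total: "(\<Sum>l<N. D l) = C i t - C i s"
  proof -
    have "(\<Sum>l<N. D l) = (\<Sum>l<N. C i (clip N l t) - C i (node N l))
        - (\<Sum>l<N. C i (clip N l s) - C i (node N l))"
      by (simp add: D_def sum_subtractf)
    then show ?thesis
      using assms by (simp add: clip_telescope)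
  qed
  have "polygon N v t $ i - polygon N v s $ i = (\<Sum>l<N. D l * g i (state N v l))"
    by (simp add: polygon_def D_def sum_subtractf[symmetric] algebra_simps)
  then have "polygon N v t $ i - polygon N v s $ i - G * (C i t - C i s) =
      (\<Sum>l<N. D l * (g i (state N v l) - G))"
    unfolding total[symmetric] by (simp add: sum_distrib_left sum_subtractf[symmetric] algebra_simps)
  also have "\<bar>\<dots>\<bar> \<le> (\<Sum>l<N. e * D l)"
  proof (rule order_trans[OF sum_abs], rule sum_mono)
    fix l assume "l \<in> {..<N}"
    then have l: "l < N"
      by simp
    have "0 \<le> D l"
      using C_clip_mono[OF assms(3) l] by (simp add: D_def)
    show "\<bar>D l * (g i (state N v l) - G)\<bar> \<le> e * D l"
    proof (cases "node N l \<le> t \<and> s \<le> node N (Suc l)")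
      case True
      then show ?thesis
        using mult_left_mono[OF near[OF l conjunct1[OF True] conjunct2[OF True]] \<open>0 \<le> D l\<close>] \<open>0 \<le> D l\<close>
        by (simp add: abs_mult mult.commute)
    next
      case False
      then have "clip N l s = clip N l t"
        using assms(3) node_mono[of l "Suc l" N] by (auto simp: clip_def)
      then show ?thesis
        by (simp add: D_def)
    qed
  qed
  also have "\<dots> = e * (C i t - C i s)"
    by (simp add: total sum_distrib_left[symmetric])
  finally show ?thesis .
qed

lemma polygon_equicontinuous:
  assumes "0 < N" "s \<in> {0..\<omega>}" "t \<in> {0..\<omega>}" "\<And>l. l < N \<Longrightarrow> \<bar>g i (state N v l)\<bar> \<le> L"
  shows "\<bar>polygon N v t $ i - polygon N v s $ i\<bar> \<le> L * \<bar>C i t - C i s\<bar>"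
proof (cases "s \<le> t")
  case True
  then show ?thesis
    using polygon_increment[of N s t i v 0 L] C_mono[of s t i] assms by auto
next
  case False
  then show ?thesis
    using polygon_increment[of N t s i v 0 L] C_mono[of t s i] assms by (auto simp: abs_minus_commute)
qed

end

section \<open>Periodic solutions as limits of Euler polygons\<close>

context periodic_system
begin

lemma damp_linear: "damp t y - damp t z = damp t (y - z)"
  by (simp add: damp_def vec_eq_iff right_diff_distrib)

lemma norm_damp_le:
  assumes "t \<in> {0..\<omega>}"
  shows "norm (damp t y) \<le> norm y"
proof (rule norm_le_componentwise_cart)
  fix i
  have "exp (- A i t) \<le> 1"
    using A_mono[of 0 t i] assms by simp
  then show "norm (damp t y $ i) \<le> norm (y $ i)"
    by (simp add: damp_def abs_mult mult_left_le_one_le)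
qed

lemma continuous_on_damp:
  assumes "continuous_on {0..\<omega>} Y"
  shows "continuous_on {0..\<omega>} (\<lambda>t. damp t (Y t))"
  unfolding damp_def by (intro continuous_intros continuous_on_A assms)

lemma damp_period_fixed:
  assumes "0 < N" "poincare N v = v"
  shows "damp \<omega> (polygon N v \<omega>) = v"
  using assms by (simp add: polygon_period poincare_def state_def)

text \<open>
  If the trajectory closes up, then its largest value \<open>euler N v N\<close> is at most \<open>v\<close> divided by the
  damping over one period. This bounds periodic trajectories from above although \<open>g\<close> may grow
  arbitrarily fast.
\<close>

lemma sum_norm_periodic_euler:
  assumes "0 < N" "v \<in> punctured_orthant" "poincare N v = v" "j \<le> N"
  shows "\<sigma> * sum_norm (euler N v j) \<le> sum_norm v"
proof -
  have "\<sigma> * sum_norm (euler N v j) \<le> \<sigma> * sum_norm (euler N v N)"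
    using assms \<sigma>_pos by (intro mult_left_mono euler_sum_norm_mono) auto
  then show ?thesis
    using state_bounds(1)[OF assms(2), of N N] assms(3) by (simp add: poincare_def)
qed

lemma periodic_state_in_shell:
  assumes "0 < N" "v \<in> shell r R" "poincare N v = v" "j \<le> N"
  shows "state N v j \<in> shell (\<sigma> * r) (R / \<sigma>)"
proof -
  have v: "v \<in> punctured_orthant" "r \<le> sum_norm v" "sum_norm v \<le> R"
    using assms(2) by (auto simp: shell_def)
  have "\<sigma> * r \<le> sum_norm (state N v j)"
    using state_lower_bound[OF v(1) assms(4)] v(2) \<sigma>_pos
    by (smt (verit) mult_left_mono)
  moreover have "sum_norm (state N v j) \<le> R / \<sigma>"
    using state_bounds(2)[OF v(1) assms(4)] sum_norm_periodic_euler[OF assms(1) v(1) assms(3,4)]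
      v(3) \<sigma>_pos by (simp add: pos_le_divide_eq mult.commute) (smt (verit) mult_left_mono)
  ultimately show ?thesis
    using state_punctured_orthant[OF v(1) assms(4)] by (simp add: shell_def)
qed

lemma damp_polygon_in_shell:
  assumes "0 < N" "v \<in> shell r R" "poincare N v = v" "t \<in> {0..\<omega>}" "0 < r"
  shows "damp t (polygon N v t) \<in> shell (\<sigma> * r) (R / \<sigma>)"
proof -
  let ?p = "polygon N v t"
  have v: "v \<in> punctured_orthant" "r \<le> sum_norm v" "sum_norm v \<le> R"
    using assms(2) by (auto simp: shell_def)
  have lower: "v $ i \<le> ?p $ i" for i
    using polygon_mono[OF v(1), of 0 t N i] assms(4) by simp
  have upper: "?p $ i \<le> euler N v N $ i" for i
    using polygon_mono[OF v(1), of t \<omega> N i] assms(1,4) by (simp add: polygon_period)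
  have nn: "0 \<le> ?p $ i" for i
    using lower[of i] punctured_orthant_nonneg[OF v(1), of i] by linarith
  have "sum_norm v \<le> sum_norm ?p"
    using lower punctured_orthant_nonneg[OF v(1)] by (intro sum_norm_mono)
  then have p: "?p \<in> punctured_orthant" "\<sigma> * r \<le> \<sigma> * sum_norm ?p"
    using nn v(2) assms(5) \<sigma>_pos by (auto intro: punctured_orthantI)
  have "\<sigma> * sum_norm ?p \<le> \<sigma> * sum_norm (euler N v N)"
    using upper nn \<sigma>_pos by (intro mult_left_mono sum_norm_mono) auto
  then have "\<sigma> * sum_norm ?p \<le> R"
    using sum_norm_periodic_euler[OF assms(1) v(1) assms(3) order_refl] v(3) by linarith
  then have "sum_norm ?p \<le> R / \<sigma>"
    using \<sigma>_pos by (simp add: pos_le_divide_eq mult.commute)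
  then show ?thesis
    using damp_sum_norm_bounds[OF assms(4) nn] p damp_punctured_orthant[OF assms(4) p(1)]
    by (simp add: shell_def)
qed

lemma g_bounded_on_shell:
  assumes "0 < r"
  obtains L where "0 \<le> L" "\<And>i u. u \<in> shell r R \<Longrightarrow> \<bar>g i u\<bar> \<le> L"
proof -
  have "\<exists>L. \<forall>u\<in>shell r R. \<bar>g i u\<bar> \<le> L" for i
  proof -
    have "continuous_on (shell r R) (g i)"
      using continuous_on_subset[OF continuous_g] by (auto simp: shell_def)
    then have "bounded (g i ` shell r R)"
      using compact_continuous_image compact_imp_bounded compact_shell[OF assms] by blast
    then show ?thesis
      by (auto simp: bounded_iff)
  qed
  then obtain L where L: "\<And>i u. u \<in> shell r R \<Longrightarrow> \<bar>g i u\<bar> \<le> L i"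
    by metis
  have "\<bar>g i u\<bar> \<le> (\<Sum>i\<in>UNIV. \<bar>L i\<bar>)" if "u \<in> shell r R" for i u
  proof -
    have "\<bar>L i\<bar> \<le> (\<Sum>i\<in>UNIV. \<bar>L i\<bar>)"
      by (rule member_le_sum) auto
    then show ?thesis
      using L[OF that, of i] by linarith
  qed
  moreover have "0 \<le> (\<Sum>i\<in>UNIV. \<bar>L i\<bar>)"
    by (simp add: sum_nonneg)
  ultimately show ?thesis
    using that by blast
qed

lemma norm_polygon_diff_le:
  assumes "0 < N" "s \<in> {0..\<omega>}" "t \<in> {0..\<omega>}" "\<And>i l. l < N \<Longrightarrow> \<bar>g i (state N v l)\<bar> \<le> L"
  shows "norm (polygon N v t - polygon N v s) \<le> (\<Sum>i\<in>UNIV. L * \<bar>C i t - C i s\<bar>)"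
proof -
  have "norm (polygon N v t - polygon N v s)
      \<le> (\<Sum>i\<in>UNIV. \<bar>(polygon N v t - polygon N v s) $ i\<bar>)"
    by (rule norm_le_l1_cart)
  also have "\<dots> \<le> (\<Sum>i\<in>UNIV. L * \<bar>C i t - C i s\<bar>)"
    using polygon_equicontinuous[OF assms] by (intro sum_mono) simp
  finally show ?thesis .
qed

text \<open>
  All states lie in one compact shell, where \<open>g\<close> is bounded by some \<open>L\<close>; hence the increments of the
  polygons are at most \<open>L\<close> times those of the \<open>C i\<close>, uniformly in the number of steps.
\<close>

lemma periodic_polygons_subsequence:
  assumes "0 < r" "\<And>n. V n \<in> shell r R" "\<And>n. poincare (Suc n) (V n) = V n"
  obtains Y k where "continuous_on {0..\<omega>} Y" "strict_mono (k :: nat \<Rightarrow> nat)"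
    "uniform_limit {0..\<omega>} (\<lambda>n. polygon (Suc (k n)) (V (k n))) Y sequentially"
proof -
  obtain L where L: "0 \<le> L" "\<And>i u. u \<in> shell (\<sigma> * r) (R / \<sigma>) \<Longrightarrow> \<bar>g i u\<bar> \<le> L"
    using g_bounded_on_shell[of "\<sigma> * r"] assms(1) \<sigma>_pos by auto
  have bound: "\<bar>g i (state (Suc n) (V n) l)\<bar> \<le> L" if "l < Suc n" for i n l
    using that assms by (intro L(2) periodic_state_in_shell) auto
  let ?P = "\<lambda>n. polygon (Suc n) (V n)"
  let ?M = "\<lambda>s t. \<Sum>i\<in>UNIV. L * \<bar>C i t - C i s\<bar>"
  have diff: "norm (?P n t - ?P n s) \<le> ?M s t" if "s \<in> {0..\<omega>}" "t \<in> {0..\<omega>}" for n s t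
    using that bound by (intro norm_polygon_diff_le) auto
  have bnd: "norm (?P n t) \<le> L * \<Gamma> + R" if t: "t \<in> {0..\<omega>}" for n t
  proof -
    have "norm (?P n t) \<le> norm (?P n t - ?P n 0) + norm (V n)"
      using norm_triangle_sub[of "?P n t" "?P n 0"] by simp
    also have "norm (?P n t - ?P n 0) \<le> ?M 0 t"
      using t period_pos by (intro diff) auto
    also have "?M 0 t \<le> L * \<Gamma>"
      unfolding \<Gamma>_def sum_distrib_left
      using t L(1) C_mono[of t \<omega>] C_nonneg[of t] by (intro sum_mono mult_left_mono) auto
    also have "norm (V n) \<le> R"
      using norm_le_sum_norm[of "V n"] assms(2)[of n] by (simp add: shell_def)
    finally show ?thesis
      by simp
  qed
  have equi: "\<exists>d>0. \<forall>n t. t \<in> {0..\<omega>} \<and> norm (s - t) < d \<longrightarrow> norm (?P n s - ?P n t) < e"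
    if s: "s \<in> {0..\<omega>}" and "0 < e" for s e
  proof -
    have "continuous_on {0..\<omega>} (?M s)"
      by (intro continuous_intros continuous_on_C)
    then obtain d where d: "d > 0" "\<And>t. t \<in> {0..\<omega>} \<Longrightarrow> dist t s < d \<Longrightarrow> dist (?M s t) (?M s s) < e"
      using continuous_on_iff[THEN iffD1, rule_format, OF _ s \<open>0 < e\<close>] by blast
    have "norm (?P n s - ?P n t) < e" if "t \<in> {0..\<omega>}" "norm (s - t) < d" for n t
    proof -
      have "dist (?M s t) (?M s s) < e"
        using d(2)[OF that(1)] that(2) by (simp add: dist_norm norm_minus_commute)
      then have "?M s t < e"
        by (simp add: dist_real_def)
      then show ?thesis
        using diff[OF s that(1), of n] by (simp add: norm_minus_commute)
    qed
    with d(1) show ?thesis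
      by blast
  qed
  have "\<exists>Y k. continuous_on {0..\<omega>} Y \<and> strict_mono (k :: nat \<Rightarrow> nat) \<and>
      (\<forall>e>0. \<exists>N. \<forall>n t. n \<ge> N \<and> t \<in> {0..\<omega>} \<longrightarrow> norm (?P (k n) t - Y t) < e)"
    by (rule Arzela_Ascoli[OF compact_Icc bnd equi]) blast+
  then obtain Y k where Y: "continuous_on {0..\<omega>} Y" "strict_mono (k :: nat \<Rightarrow> nat)"
      and conv: "\<And>e. 0 < e \<Longrightarrow> \<exists>N. \<forall>n t. n \<ge> N \<and> t \<in> {0..\<omega>} \<longrightarrow> norm (?P (k n) t - Y t) < e"
    by blast
  have "uniform_limit {0..\<omega>} (\<lambda>n. polygon (Suc (k n)) (V (k n))) Y sequentially"
    unfolding uniform_limit_sequentially_iff dist_norm using conv by blast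
  with Y that show ?thesis
    by blast
qed

text \<open>
  Near \<open>t\<^sub>0\<close> and for fine grids, every state that contributes to the increment of the polygon over
  \<open>[t\<^sub>0, t]\<close> is close to \<open>damp t\<^sub>0 (Y t\<^sub>0)\<close>, so there \<open>g i\<close> is nearly constant.
\<close>

lemma polygon_limit_deriv:
  assumes V: "\<And>n. V n \<in> punctured_orthant"
    and Y: "continuous_on {0..\<omega>} Y" "strict_mono (k :: nat \<Rightarrow> nat)"
    and lim: "uniform_limit {0..\<omega>} (\<lambda>n. polygon (Suc (k n)) (V (k n))) Y sequentially"
    and t\<^sub>0: "t\<^sub>0 \<in> {0..\<omega>}"
    and X: "damp t\<^sub>0 (Y t\<^sub>0) \<in> punctured_orthant"
  shows "((\<lambda>t. Y t $ i) has_real_derivative g i (damp t\<^sub>0 (Y t\<^sub>0)) * (exp (A i t\<^sub>0) * b i t\<^sub>0))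
    (at t\<^sub>0 within {0..\<omega>})"
proof (rule has_real_derivative_relative_increments[OF C_deriv[OF t\<^sub>0]])
  fix e :: real assume "0 < e"
  let ?X = "\<lambda>t. damp t (Y t)"
  let ?P = "\<lambda>n. polygon (Suc (k n)) (V (k n))"
  define G where "G = g i (?X t\<^sub>0)"
  obtain \<eta> where \<eta>: "0 < \<eta>"
      "\<And>u. u \<in> punctured_orthant \<Longrightarrow> dist u (?X t\<^sub>0) < \<eta> \<Longrightarrow> dist (g i u) G < e"
    using continuous_on_iff[THEN iffD1, rule_format, OF continuous_g[of i] X \<open>0 < e\<close>]
    unfolding G_def by blast
  obtain d where d: "0 < d" "\<And>t. t \<in> {0..\<omega>} \<Longrightarrow> dist t t\<^sub>0 < d \<Longrightarrow> dist (?X t) (?X t\<^sub>0) < \<eta> / 2"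
    using continuous_on_iff[THEN iffD1, rule_format,
        OF continuous_on_damp[OF Y(1)] t\<^sub>0 half_gt_zero[OF \<eta>(1)]] by blast
  have fine: "\<forall>\<^sub>F n in sequentially. \<omega> / real (Suc (k n)) < d / 2"
  proof -
    have "(\<lambda>n. \<omega> / real (Suc n)) \<longlonglongrightarrow> 0"
      using LIMSEQ_Suc[OF lim_const_over_n[of \<omega>]] by simp
    then have "(\<lambda>n. \<omega> / real (Suc (k n))) \<longlonglongrightarrow> 0"
      using LIMSEQ_subseq_LIMSEQ[OF _ Y(2)] by (fastforce simp: o_def)
    then show ?thesis
      using d(1) by (intro order_tendstoD) auto
  qed
  have close: "\<forall>\<^sub>F n in sequentially. \<forall>t\<in>{0..\<omega>}. dist (?P n t) (Y t) < \<eta> / 2"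
    using lim \<eta>(1) by (intro uniform_limitD) auto
  have step: "\<bar>Y t $ i - Y s $ i - G * (C i t - C i s)\<bar> \<le> e * (C i t - C i s)"
    if st: "0 \<le> s" "s \<le> t" "t \<le> \<omega>" "t\<^sub>0 - d / 2 < s" "t < t\<^sub>0 + d / 2" "s \<le> t\<^sub>0" "t\<^sub>0 \<le> t" for s t
  proof (rule tendsto_upperbound)
    have "(\<lambda>n. ?P n s) \<longlonglongrightarrow> Y s" "(\<lambda>n. ?P n t) \<longlonglongrightarrow> Y t"
      using st by (auto intro!: tendsto_uniform_limitI[OF lim])
    then show "(\<lambda>n. \<bar>?P n t $ i - ?P n s $ i - G * (C i t - C i s)\<bar>)
        \<longlonglongrightarrow> \<bar>Y t $ i - Y s $ i - G * (C i t - C i s)\<bar>"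
      by (intro tendsto_intros)
    show "\<forall>\<^sub>F n in sequentially. \<bar>?P n t $ i - ?P n s $ i - G * (C i t - C i s)\<bar>
        \<le> e * (C i t - C i s)"
      using fine close
    proof eventually_elim
      case (elim n)
      let ?N = "Suc (k n)" and ?v = "V (k n)"
      show ?case
      proof (rule polygon_increment)
        fix l assume l: "l < ?N" "node ?N l \<le> t" "s \<le> node ?N (Suc l)"
        let ?\<tau> = "node ?N l"
        have \<tau>: "?\<tau> \<in> {0..\<omega>}"
          using l(1) by (simp add: node_nonneg node_le)
        have "\<bar>?\<tau> - t\<^sub>0\<bar> < d"
          using l st elim(1) node_Suc[of ?N l] by linarith
        then have "dist (?X ?\<tau>) (?X t\<^sub>0) < \<eta> / 2"
          using \<tau> d(2) by (simp add: dist_real_def)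
        moreover have "dist (state ?N ?v l) (?X ?\<tau>) < \<eta> / 2"
        proof -
          have "dist (state ?N ?v l) (?X ?\<tau>) = norm (damp ?\<tau> (?P n ?\<tau> - Y ?\<tau>))"
            using l(1) by (simp add: state_def polygon_node dist_norm damp_linear)
          also have "\<dots> \<le> dist (?P n ?\<tau>) (Y ?\<tau>)"
            using norm_damp_le[OF \<tau>] by (simp add: dist_norm)
          also have "\<dots> < \<eta> / 2"
            using elim(2) \<tau> by blast
          finally show ?thesis .
        qed
        ultimately have "dist (state ?N ?v l) (?X t\<^sub>0) < \<eta>"
          by (metis dist_commute dist_triangle_half_r)
        moreover have "state ?N ?v l \<in> punctured_orthant"
          using V[of "k n"] l(1) by (intro state_punctured_orthant) auto
        ultimately have "dist (g i (state ?N ?v l)) G < e"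
          by (intro \<eta>(2))
        then show "\<bar>g i (state ?N ?v l) - G\<bar> \<le> e"
          by (simp add: dist_real_def)
      qed (use st in auto)
    qed
  qed simp
  have "\<bar>Y t $ i - Y t\<^sub>0 $ i - G * (C i t - C i t\<^sub>0)\<bar> \<le> e * \<bar>C i t - C i t\<^sub>0\<bar>"
    if t: "t \<in> {0..\<omega>}" "\<bar>t - t\<^sub>0\<bar> < d / 2" for t
  proof (cases "t\<^sub>0 \<le> t")
    case True
    then show ?thesis
      using step[of t\<^sub>0 t] C_mono[of t\<^sub>0 t i] t t\<^sub>0 d(1) by auto
  next
    case False
    then have "\<bar>Y t\<^sub>0 $ i - Y t $ i - G * (C i t\<^sub>0 - C i t)\<bar> \<le> e * (C i t\<^sub>0 - C i t)"
      using step[of t t\<^sub>0] t t\<^sub>0 d(1) by auto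
    moreover have "C i t \<le> C i t\<^sub>0"
      using False t t\<^sub>0 by (intro C_mono) auto
    moreover have "Y t $ i - Y t\<^sub>0 $ i - G * (C i t - C i t\<^sub>0) =
        - (Y t\<^sub>0 $ i - Y t $ i - G * (C i t\<^sub>0 - C i t))"
      by (simp add: algebra_simps)
    ultimately show ?thesis
      by (simp only: abs_minus_cancel) simp
  qed
  then show "\<exists>d>0. \<forall>t\<in>{0..\<omega>}. \<bar>t - t\<^sub>0\<bar> < d \<longrightarrow>
      \<bar>Y t $ i - Y t\<^sub>0 $ i - g i (?X t\<^sub>0) * (C i t - C i t\<^sub>0)\<bar> \<le> e * \<bar>C i t - C i t\<^sub>0\<bar>"
    using d(1) by (intro exI[of _ "d / 2"]) (auto simp: G_def)
qed

lemma damp_0 [simp]: "damp 0 y = y"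
  by (simp add: damp_def vec_eq_iff)

text \<open>
  The limit of the polygons solves the equation on one period and is continued periodically. Strict
  positivity: a component that vanishes at time 0 also vanishes at time \<open>\<omega>\<close>, so its nondecreasing
  \<open>y i\<close> vanishes on the whole period, and the equation forces \<open>b i = 0\<close> there.
\<close>

lemma periodic_solution_of_polygons:
  assumes "0 < r" and V: "\<And>n. V n \<in> shell r R" "\<And>n. poincare (Suc n) (V n) = V n"
  obtains x where "positive_periodic_solution a b g \<omega> 1 x" "r \<le> sum_norm (x 0)" "sum_norm (x 0) \<le> R"
proof -
  obtain Y k where Y: "continuous_on {0..\<omega>} Y" "strict_mono (k :: nat \<Rightarrow> nat)"
    and lim: "uniform_limit {0..\<omega>} (\<lambda>n. polygon (Suc (k n)) (V (k n))) Y sequentially"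
    using periodic_polygons_subsequence[OF assms] .
  let ?P = "\<lambda>n. polygon (Suc (k n)) (V (k n))"
  define X where "X t = damp t (Y t)" for t
  have ends: "0 \<in> {0..\<omega>}" "\<omega> \<in> {0..\<omega>}"
    using period_pos by auto
  have lim_at: "(\<lambda>n. ?P n t) \<longlonglongrightarrow> Y t" if "t \<in> {0..\<omega>}" for t
    using tendsto_uniform_limitI[OF lim that] .
  have lim_damp: "(\<lambda>n. damp t (?P n t)) \<longlonglongrightarrow> X t" if "t \<in> {0..\<omega>}" for t
    unfolding X_def damp_def by (intro tendsto_intros lim_at that)
  have X_po: "X t \<in> punctured_orthant" if "t \<in> {0..\<omega>}" for t
  proof -
    have "closed (shell (\<sigma> * r) (R / \<sigma>) :: (real ^ 'n) set)"
      using assms(1) \<sigma>_pos by (intro compact_imp_closed compact_shell) simp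
    then have "X t \<in> shell (\<sigma> * r) (R / \<sigma>)"
      by (rule closed_sequentially[OF _ _ lim_damp[OF that]])
        (use V assms(1) that in \<open>auto intro: damp_polygon_in_shell\<close>)
    then show ?thesis
      by (simp add: shell_def)
  qed
  have "closed (shell r R :: (real ^ 'n) set)"
    using assms(1) by (intro compact_imp_closed compact_shell)
  then have Y0: "Y 0 \<in> shell r R"
    by (rule closed_sequentially[OF _ _ lim_at[OF ends(1)]]) (simp add: V)
  have X0: "X 0 = Y 0"
    by (simp add: X_def)
  have X_period: "X \<omega> = X 0"
  proof -
    have "damp \<omega> (?P n \<omega>) = ?P n 0" for n
      using damp_period_fixed[OF _ V(2), of "k n"] by simp
    then show ?thesis
      using LIMSEQ_unique[OF lim_damp[OF ends(2)]] lim_at[OF ends(1)] X0 by simp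
  qed
  have V_po: "V n \<in> punctured_orthant" for n
    using V(1)[of n] by (simp add: shell_def)
  have Y_mono: "Y s $ i \<le> Y t $ i" if "s \<in> {0..\<omega>}" "t \<in> {0..\<omega>}" "s \<le> t" for s t i
    using that V_po
    by (intro LIMSEQ_le[OF tendsto_vec_nth[OF lim_at] tendsto_vec_nth[OF lim_at]])
      (auto intro: polygon_mono)
  have Y_deriv: "((\<lambda>t. Y t $ i) has_real_derivative g i (X t) * (exp (A i t) * b i t))
      (at t within {0..\<omega>})" if "t \<in> {0..\<omega>}" for i t
    unfolding X_def
    by (rule polygon_limit_deriv[OF V_po Y lim that X_po[OF that, unfolded X_def]])
  have Y0_pos: "0 < Y 0 $ i" for i
  proof (rule ccontr)
    assume "\<not> 0 < Y 0 $ i"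
    then have zero: "Y 0 $ i = 0"
      using Y0 punctured_orthant_nonneg[of "Y 0" i] by (simp add: shell_def)
    then have "Y \<omega> $ i = 0"
      using X_period X0 by (simp add: X_def damp_def vec_eq_iff) (metis exp_not_eq_zero mult_eq_0_iff)
    then have const: "Y t $ i = 0" if "t \<in> {0..\<omega>}" for t
      using Y_mono[OF ends(1) that, of i] Y_mono[OF that ends(2), of i] that zero by auto
    have "b i t = 0" if t: "t \<in> {0..\<omega>}" for t
    proof -
      have "((\<lambda>t. Y t $ i) has_real_derivative 0) (at t within {0..\<omega>})"
        by (rule has_field_derivative_transform_within[of "\<lambda>_. 0" 0 t _ 1]) (use t const in auto)
      then have "g i (X t) * (exp (A i t) * b i t) = 0"
        using Y_deriv[OF t, of i] t
        unfolding has_real_derivative_iff_has_vector_derivative cbox_interval[symmetric]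
        by (intro vector_derivative_unique_within_closed_interval[OF period_pos])
      then show ?thesis
        using g_pos[OF X_po[OF t], of i] by simp
    qed
    then have "integral {0..\<omega>} (b i) = integral {0..\<omega>} (\<lambda>t. 0)"
      by (intro integral_cong) auto
    then show False
      using b_mass[of i] by simp
  qed
  have X_pos: "0 < X t $ i" if "t \<in> {0..\<omega>}" for t i
    using Y0_pos[of i] Y_mono[OF ends(1) that, of i] that by (simp add: X_def damp_def)
  define D where "D i t = - a i t * X t $ i + b i t * g i (X t)" for i t
  have X_deriv: "((\<lambda>t. X t $ i) has_real_derivative D i t) (at t within {0..\<omega>})"
    if t: "t \<in> {0..\<omega>}" for i t
  proof -
    have "((\<lambda>t. exp (- A i t) * Y t $ i) has_real_derivative
        exp (- A i t) * - a i t * Y t $ i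
        + g i (X t) * (exp (A i t) * b i t) * exp (- A i t)) (at t within {0..\<omega>})"
      by (intro DERIV_mult Y_deriv t DERIV_chain2[OF DERIV_exp] DERIV_minus A_deriv)
    moreover have "exp (- A i t) * - a i t * Y t $ i
        + g i (X t) * (exp (A i t) * b i t) * exp (- A i t) = D i t"
      by (simp add: D_def X_def damp_def exp_minus)
    ultimately show ?thesis
      by (simp add: X_def damp_def)
  qed
  have a_wrap: "a i (wrap \<omega> t) = a i t" and b_wrap: "b i (wrap \<omega> t) = b i t" for i t
    by (rule periodic_wrap[OF a_periodic], rule periodic_wrap[OF b_periodic])
  have D_period: "D i \<omega> = D i 0" for i
    using a_wrap[of i \<omega>] b_wrap[of i \<omega>] X_period period_pos by (simp add: D_def wrap_def)
  define x where "x t = X (wrap \<omega> t)" for t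
  have "periodic_fun_simple x \<omega>"
    using wrap_add_period[OF period_pos] by unfold_locales (simp add: x_def)
  moreover have "0 < x t $ i" for t i
    using X_pos[of "wrap \<omega> t" i] wrap_bounds[OF period_pos, of t] by (simp add: x_def)
  moreover have "((\<lambda>s. x s $ i) has_real_derivative - a i t * x t $ i + 1 * b i t * g i (x t)) (at t)"
    for t i
    using has_real_derivative_wrap[of \<omega> "\<lambda>t. X t $ i" "D i" t] period_pos X_period D_period X_deriv
    by (simp add: x_def D_def a_wrap b_wrap)
  ultimately have "positive_periodic_solution a b g \<omega> 1 x"
    unfolding positive_periodic_solution_def by blast
  moreover have "x 0 = Y 0"
    by (simp add: x_def wrap_def X0)
  ultimately show ?thesis
    using that[of x] Y0 by (simp add: shell_def)
qed

text \<open>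
  The boundary conditions are required for every number of steps, since the solution is a limit of
  fixed points of the maps \<open>poincare N\<close>.
\<close>

theorem periodic_solution_in_shell:
  assumes "0 < r" "r \<le> R" "s \<noteq> 0"
    and inner: "\<And>N v. 0 < N \<Longrightarrow> v \<in> punctured_orthant \<Longrightarrow> sum_norm v = r \<Longrightarrow>
      0 \<le> s * (sum_norm (poincare N v) - r)"
    and outer: "\<And>N v. 0 < N \<Longrightarrow> v \<in> punctured_orthant \<Longrightarrow> sum_norm v = R \<Longrightarrow>
      s * (sum_norm (poincare N v) - R) \<le> 0"
  obtains x where "positive_periodic_solution a b g \<omega> 1 x" "r \<le> sum_norm (x 0)" "sum_norm (x 0) \<le> R"
proof -
  have "\<exists>v. v \<in> shell r R \<and> poincare (Suc n) v = v" for n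
  proof (rule shell_fixed_point[OF assms(1-3)])
    show "continuous_on (shell r R) (poincare (Suc n))"
      by (rule continuous_on_subset[OF continuous_on_poincare]) (auto simp: shell_def)
    show "poincare (Suc n) u \<in> punctured_orthant" if "u \<in> shell r R" for u
      using that by (auto simp: poincare_def shell_def intro: state_punctured_orthant)
  qed (use inner outer in auto)
  then obtain V where V: "\<And>n. V n \<in> shell r R" "\<And>n. poincare (Suc n) (V n) = V n"
    by metis
  then show ?thesis
    using periodic_solution_of_polygons[OF assms(1)] that by blast
qed

section \<open>Compression and expansion criteria\<close>

lemma poincare_lower:
  assumes "0 < N" "v \<in> punctured_orthant" "0 \<le> m" "\<And>l. l < N \<Longrightarrow> m \<le> g i (state N v l)"
  shows "\<sigma> * m * C i \<omega> \<le> sum_norm (poincare N v)"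
proof -
  have nn: "0 \<le> euler N v N $ i"
    using punctured_orthant_nonneg[OF euler_punctured_orthant[OF assms(2) order_refl]] .
  have "m * C i \<omega> \<le> euler N v N $ i"
    using euler_lower[of N m i N v] assms punctured_orthant_nonneg[OF assms(2), of i] by simp
  then have "\<sigma> * m * C i \<omega> \<le> \<sigma> * euler N v N $ i"
    using \<sigma>_pos by (simp add: mult.assoc)
  also have "\<dots> \<le> exp (- A i \<omega>) * euler N v N $ i"
    using \<sigma>_le nn by (intro mult_right_mono)
  also have "\<dots> = poincare N v $ i"
    using assms(1) by (simp add: poincare_def state_def damp_def)
  also have "\<dots> \<le> sum_norm (poincare N v)"
    by (rule component_le_sum_norm)
  finally show ?thesis .
qed

text \<open>
  Either the trajectory leaves the region where \<open>g i\<close> is large, and then its norm after the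
  remaining damping is still at least \<open>\<sigma> * \<delta>\<close>, or it stays there, and then its \<open>i\<close>-th component alone
  is at least \<open>\<delta>\<close> at the end.
\<close>

lemma poincare_ge_singular:
  assumes "0 < N" "v \<in> punctured_orthant" "sum_norm v \<le> \<sigma> * \<delta>"
    and "0 \<le> m" "\<delta> \<le> \<sigma> * m * C i \<omega>"
    and large: "\<And>u. u \<in> punctured_orthant \<Longrightarrow> sum_norm u \<le> \<delta> \<Longrightarrow> m \<le> g i u"
  shows "sum_norm v \<le> sum_norm (poincare N v)"
proof (cases "\<exists>l<N. \<delta> < sum_norm (state N v l)")
  case True
  then obtain l where l: "l < N" "\<delta> < sum_norm (state N v l)"
    by blast
  then have "\<delta> \<le> sum_norm (euler N v N)"
    using state_bounds(2)[OF assms(2), of l N] euler_sum_norm_mono[OF assms(2), of l N N] by simp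
  then have "\<sigma> * \<delta> \<le> \<sigma> * sum_norm (euler N v N)"
    using \<sigma>_pos by simp
  then show ?thesis
    using state_bounds(1)[OF assms(2), of N N] assms(3) by (simp add: poincare_def)
next
  case False
  have "\<sigma> * m * C i \<omega> \<le> sum_norm (poincare N v)"
  proof (rule poincare_lower)
    show "m \<le> g i (state N v l)" if "l < N" for l
      using that False by (intro large state_punctured_orthant assms) auto
  qed (use assms in auto)
  moreover have "0 < \<delta>"
    using sum_norm_pos[OF assms(2)] assms(3) \<sigma>_pos by (smt (verit) zero_less_mult_pos)
  then have "\<sigma> * \<delta> \<le> \<delta>"
    using \<sigma>_le_1 by simp
  ultimately show ?thesis
    using assms(3,5) by linarith
qed

lemma poincare_ge_superlinear:
  assumes "0 < N" "v \<in> punctured_orthant"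
    and "0 \<le> m" "1 \<le> \<sigma>\<^sup>2 * m * C i \<omega>"
    and large: "\<And>u. u \<in> punctured_orthant \<Longrightarrow> \<sigma> * sum_norm v \<le> sum_norm u \<Longrightarrow> m * sum_norm u \<le> g i u"
  shows "sum_norm v \<le> sum_norm (poincare N v)"
proof -
  let ?m = "m * (\<sigma> * sum_norm v)"
  have "sum_norm v * 1 \<le> sum_norm v * (\<sigma>\<^sup>2 * m * C i \<omega>)"
    using assms(4) sum_norm_nonneg by (intro mult_left_mono)
  also have "\<dots> = \<sigma> * ?m * C i \<omega>"
    by (simp add: power2_eq_square)
  also have "\<dots> \<le> sum_norm (poincare N v)"
  proof (rule poincare_lower)
    fix l assume "l < N"
    then have l: "\<sigma> * sum_norm v \<le> sum_norm (state N v l)" "state N v l \<in> punctured_orthant"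
      using assms(2) by (auto intro: state_lower_bound state_punctured_orthant)
    then have "?m \<le> m * sum_norm (state N v l)"
      using assms(3) by (intro mult_left_mono)
    then show "?m \<le> g i (state N v l)"
      using large[OF l(2,1)] by linarith
  qed (use assms \<sigma>_pos sum_norm_nonneg[of v] in auto)
  finally show ?thesis
    by simp
qed

text \<open>
  The bound on \<open>g\<close> is assumed only up to norm \<open>2 * \<rho>\<close>. It suffices because the growth is at most
  \<open>m * \<Gamma> \<le> \<rho>\<close> as long as the bound applies, so by induction over the steps the trajectory
  never leaves this range. Damping by \<open>\<theta> < 1\<close> then compensates for the growth.
\<close>

lemma poincare_le:
  assumes "0 < N" "v \<in> punctured_orthant" "sum_norm v = \<rho>" "m * \<Gamma> \<le> (1 - \<theta>) * \<rho>"
    and small: "\<And>i u. u \<in> shell (\<sigma> * \<rho>) (2 * \<rho>) \<Longrightarrow> g i u \<le> m"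
  shows "sum_norm (poincare N v) \<le> \<rho>"
proof -
  have "0 < \<rho>"
    using sum_norm_pos assms(2,3) by blast
  have "0 < \<theta>"
    using \<theta>_ge[of undefined] by (smt (verit) exp_gt_zero)
  then have le_\<rho>: "m * \<Gamma> \<le> \<rho>"
    using assms(4) \<open>0 < \<rho>\<close> by (smt (verit) mult_le_cancel_right2)
  have "v \<in> shell (\<sigma> * \<rho>) (2 * \<rho>)"
    using assms(2,3) \<sigma>_le_1 \<open>0 < \<rho>\<close> by (simp add: shell_def)
  then have "0 < m"
    by (rule less_le_trans[OF g_pos[OF assms(2)] small])
  have sum_v: "(\<Sum>i\<in>UNIV. v $ i) = \<rho>"
    using sum_norm_eq_sum[of v] punctured_orthant_nonneg[OF assms(2)] assms(3) by simp
  have growth: "sum_norm (euler N v j) \<le> 2 * \<rho> \<and> (\<forall>i. euler N v j $ i \<le> v $ i + m * C i \<omega>)"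
    if "j \<le> N" for j
    using that
  proof (induction j rule: less_induct)
    case (less j)
    have comp: "euler N v j $ i \<le> v $ i + m * C i \<omega>" for i
    proof -
      have "euler N v j $ i \<le> v $ i + m * C i (node N j)"
      proof (rule euler_upper)
        fix l assume "l < j"
        then have "l \<le> N" "sum_norm (euler N v l) \<le> 2 * \<rho>"
          using less by auto
        then show "g i (state N v l) \<le> m"
          using state_bounds(2)[OF assms(2), of l N] state_lower_bound[OF assms(2), of l N]
            state_punctured_orthant[OF assms(2), of l N] assms(3)
          by (intro small) (simp add: shell_def)
      qed (use less.prems in auto)
      also have "\<dots> \<le> v $ i + m * C i \<omega>"
        using C_mono[OF node_nonneg node_le[OF less.prems] order_refl] \<open>0 < m\<close> by simp
      finally show ?thesis .
    qed
    have "sum_norm (euler N v j) = (\<Sum>i\<in>UNIV. euler N v j $ i)"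
      using punctured_orthant_nonneg[OF euler_punctured_orthant[OF assms(2) less.prems]]
      by (rule sum_norm_eq_sum)
    also have "\<dots> \<le> (\<Sum>i\<in>UNIV. v $ i + m * C i \<omega>)"
      by (intro sum_mono comp)
    also have "\<dots> = \<rho> + m * \<Gamma>"
      by (simp add: sum.distrib sum_v \<Gamma>_def sum_distrib_left)
    finally show ?case
      using comp le_\<rho> by simp
  qed
  have "poincare N v \<in> punctured_orthant"
    unfolding poincare_def using assms(2) by (intro state_punctured_orthant) auto
  then have "sum_norm (poincare N v) = (\<Sum>i\<in>UNIV. poincare N v $ i)"
    by (intro sum_norm_eq_sum punctured_orthant_nonneg)
  also have "\<dots> \<le> (\<Sum>i\<in>UNIV. \<theta> * v $ i + m * C i \<omega>)"
  proof (rule sum_mono)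
    fix i
    have nn: "0 \<le> v $ i" "0 \<le> m * C i \<omega>"
      using punctured_orthant_nonneg[OF assms(2)] \<open>0 < m\<close> C_period_pos[of i] by auto
    have "poincare N v $ i = exp (- A i \<omega>) * euler N v N $ i"
      using assms(1) by (simp add: poincare_def state_def damp_def)
    also have "\<dots> \<le> exp (- A i \<omega>) * (v $ i + m * C i \<omega>)"
      using growth[of N] by simp
    also have "\<dots> \<le> \<theta> * (v $ i + m * C i \<omega>)"
      using \<theta>_ge nn by (intro mult_right_mono) auto
    also have "\<dots> \<le> \<theta> * v $ i + m * C i \<omega>"
      using mult_right_mono[OF less_imp_le[OF \<theta>_less_1] nn(2)] by (simp add: distrib_left)
    finally show "poincare N v $ i \<le> \<theta> * v $ i + m * C i \<omega>" .
  qed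
  also have "\<dots> = \<theta> * \<rho> + m * \<Gamma>"
    by (simp add: sum.distrib \<Gamma>_def sum_v sum_distrib_left[symmetric])
  also have "\<dots> \<le> \<rho>"
    using assms(4) by (simp add: algebra_simps)
  finally show ?thesis .
qed

text \<open>
  The lower estimate holds on all spheres of radius up to \<open>\<sigma> * \<delta>\<close>; the minimum with \<open>R\<close> ensures that
  the shell is nonempty.
\<close>

theorem compression_solution:
  assumes "0 < R" "0 < \<delta>" "0 \<le> m\<^sub>1" "\<delta> \<le> \<sigma> * m\<^sub>1 * C i \<omega>" "m\<^sub>2 * \<Gamma> \<le> (1 - \<theta>) * R"
    and "\<And>u. u \<in> punctured_orthant \<Longrightarrow> sum_norm u \<le> \<delta> \<Longrightarrow> m\<^sub>1 \<le> g i u"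
    and "\<And>j u. u \<in> shell (\<sigma> * R) (2 * R) \<Longrightarrow> g j u \<le> m\<^sub>2"
  obtains x where "positive_periodic_solution a b g \<omega> 1 x" "sum_norm (x 0) \<le> R"
proof (rule periodic_solution_in_shell[of "min R (\<sigma> * \<delta>)" R 1])
  fix N :: nat and v :: "real ^ 'n"
  assume v: "0 < N" "v \<in> punctured_orthant"
  show "0 \<le> 1 * (sum_norm (poincare N v) - min R (\<sigma> * \<delta>))" if "sum_norm v = min R (\<sigma> * \<delta>)"
    using poincare_ge_singular[OF v _ assms(3,4,6)] that by simp
  show "1 * (sum_norm (poincare N v) - R) \<le> 0" if "sum_norm v = R"
    using poincare_le[OF v that assms(5,7)] by simp
qed (use assms(1,2) \<sigma>_pos that in auto)

theorem expansion_solution: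
  assumes "0 < r" "r \<le> R" "0 \<le> m\<^sub>2" "1 \<le> \<sigma>\<^sup>2 * m\<^sub>2 * C i \<omega>" "m\<^sub>1 * \<Gamma> \<le> (1 - \<theta>) * r"
    and "\<And>j u. u \<in> shell (\<sigma> * r) (2 * r) \<Longrightarrow> g j u \<le> m\<^sub>1"
    and "\<And>u. u \<in> punctured_orthant \<Longrightarrow> \<sigma> * R \<le> sum_norm u \<Longrightarrow> m\<^sub>2 * sum_norm u \<le> g i u"
  obtains x where "positive_periodic_solution a b g \<omega> 1 x" "r \<le> sum_norm (x 0)"
proof (rule periodic_solution_in_shell[of r R "-1"])
  fix N :: nat and v :: "real ^ 'n"
  assume v: "0 < N" "v \<in> punctured_orthant"
  show "0 \<le> -1 * (sum_norm (poincare N v) - r)" if "sum_norm v = r"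
    using poincare_le[OF v that assms(5,6)] by simp
  show "-1 * (sum_norm (poincare N v) - R) \<le> 0" if "sum_norm v = R"
    using poincare_ge_superlinear[OF v assms(3,4)] assms(7) that by simp
qed (use assms(1,2) that in auto)

end

section \<open>Dependence on the parameter\<close>

lemma large_near_0:
  fixes h :: "real ^ 'n \<Rightarrow> real"
  assumes "filterlim h at_top sum_norm_to_0"
  obtains \<delta> where "0 < \<delta>" "\<And>u. u \<in> punctured_orthant \<Longrightarrow> sum_norm u < \<delta> \<Longrightarrow> M \<le> h u"
proof -
  have "eventually (\<lambda>u. M \<le> h u) sum_norm_to_0"
    using assms by (simp add: filterlim_at_top)
  then obtain \<delta> where "0 < \<delta>"
      "\<And>u. dist (sum_norm u) 0 < \<delta> \<Longrightarrow> u \<in> punctured_orthant \<Longrightarrow> M \<le> h u"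
    unfolding sum_norm_to_0_def eventually_inf_principal eventually_filtercomap
      eventually_nhds_metric by blast
  then show ?thesis
    using that[of \<delta>] by (auto simp: abs_of_nonneg[OF sum_norm_nonneg])
qed

lemma eventually_sum_norm_to_infinity:
  assumes "eventually P sum_norm_to_infinity"
  obtains \<rho> where "\<And>u. u \<in> punctured_orthant \<Longrightarrow> \<rho> \<le> sum_norm u \<Longrightarrow> P u"
  using assms unfolding sum_norm_to_infinity_def eventually_inf_principal eventually_filtercomap
    eventually_at_top_linorder by blast

context periodic_system
begin

lemma scaled_system: "0 < lam \<Longrightarrow> periodic_system a b \<omega> (\<lambda>i u. lam * g i u)"
  by unfold_locales (auto intro!: continuous_intros continuous_g simp: g_pos)

lemma scaled_solution:
  "positive_periodic_solution a b (\<lambda>i u. lam * g i u) \<omega> 1 x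
     \<longleftrightarrow> positive_periodic_solution a b g \<omega> lam x"
  by (simp add: positive_periodic_solution_def ac_simps)

text \<open>
  The compression criterion for the nonlinearities \<open>lam * g i\<close>: the singularity provides a
  sufficiently large value near 0 for every positive \<open>lam\<close>.
\<close>

lemma singular_solution:
  assumes sing: "filterlim (g i) at_top sum_norm_to_0"
    and "0 < lam" "0 < R" "lam * m * \<Gamma> \<le> (1 - \<theta>) * R"
    and small: "\<And>j u. u \<in> shell (\<sigma> * R) (2 * R) \<Longrightarrow> g j u \<le> m"
  obtains x where "positive_periodic_solution a b g \<omega> lam x" "sum_norm (x 0) \<le> R"
proof -
  \<comment> \<open>The criterion needs the threshold for the norm to be at most \<open>\<sigma> * (lam * M) * C i \<omega>\<close>, which is 1.\<close>
  define M where "M = 1 / (\<sigma> * lam * C i \<omega>)"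
  have "0 < \<sigma> * lam * C i \<omega>"
    using assms(2) \<sigma>_pos C_period_pos by simp
  then have "0 < M" and M: "\<sigma> * (lam * M) * C i \<omega> = 1"
    by (auto simp: M_def)
  obtain \<delta> where \<delta>: "0 < \<delta>" "\<And>u. u \<in> punctured_orthant \<Longrightarrow> sum_norm u < \<delta> \<Longrightarrow> M \<le> g i u"
    using large_near_0[OF sing] by blast
  show ?thesis
  proof (rule periodic_system.compression_solution[OF scaled_system[OF assms(2)],
        of R "min 1 (\<delta> / 2)" "lam * M" i "lam * m"])
    fix u :: "real ^ 'n"
    assume "u \<in> punctured_orthant" "sum_norm u \<le> min 1 (\<delta> / 2)"
    then show "lam * M \<le> lam * g i u"
      using \<delta> assms(2) by simp
  qed (use assms \<delta>(1) M \<open>0 < M\<close> that in \<open>simp_all add: scaled_solution\<close>)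
qed

lemma small_parameter:
  assumes "0 < \<rho>"
  obtains lam\<^sub>0 m where "0 < lam\<^sub>0" "\<And>j u. u \<in> shell (\<sigma> * \<rho>) (2 * \<rho>) \<Longrightarrow> g j u \<le> m"
    "\<And>lam. 0 < lam \<Longrightarrow> lam < lam\<^sub>0 \<Longrightarrow> lam * m * \<Gamma> \<le> (1 - \<theta>) * \<rho>"
proof -
  obtain L where L: "0 \<le> L" "\<And>i u. u \<in> shell (\<sigma> * \<rho>) (2 * \<rho>) \<Longrightarrow> \<bar>g i u\<bar> \<le> L"
    using g_bounded_on_shell[of "\<sigma> * \<rho>"] assms \<sigma>_pos by auto
  \<comment> \<open>\<open>L\<close> is only known to be nonnegative, and the bound on the parameter divides by it.\<close>
  have pos: "0 < (L + 1) * \<Gamma>" "0 < (1 - \<theta>) * \<rho>"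
    using L(1) \<Gamma>_pos \<theta>_less_1 assms by simp_all
  show ?thesis
  proof (rule that[of "(1 - \<theta>) * \<rho> / ((L + 1) * \<Gamma>)" "L + 1"])
    show "0 < (1 - \<theta>) * \<rho> / ((L + 1) * \<Gamma>)"
      using pos by simp
    show "g j u \<le> L + 1" if "u \<in> shell (\<sigma> * \<rho>) (2 * \<rho>)" for j u
      using L(2)[OF that, of j] by linarith
    show "lam * (L + 1) * \<Gamma> \<le> (1 - \<theta>) * \<rho>" if "lam < (1 - \<theta>) * \<rho> / ((L + 1) * \<Gamma>)" for lam
      using that pos by (simp add: pos_less_divide_eq mult.assoc)
  qed
qed

theorem solution_if_sublinear:
  assumes sing: "filterlim (g i) at_top sum_norm_to_0" and "0 < lam"
    and sub: "\<And>i. ((\<lambda>u. g i u / sum_norm u) \<longlongrightarrow> 0) sum_norm_to_infinity"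
  shows "\<exists>x. positive_periodic_solution a b g \<omega> lam x"
proof -
  define \<eta> where "\<eta> = (1 - \<theta>) / (2 * lam * \<Gamma>)"
  have \<eta>: "0 < \<eta>" "lam * \<eta> * 2 * \<Gamma> = 1 - \<theta>"
    using \<theta>_less_1 assms(2) \<Gamma>_pos by (auto simp: \<eta>_def)
  have "eventually (\<lambda>u. \<forall>i. g i u / sum_norm u < \<eta>) sum_norm_to_infinity"
    using order_tendstoD(2)[OF sub \<eta>(1)] by (simp add: eventually_all_finite)
  then obtain \<rho> where \<rho>: "\<And>u. u \<in> punctured_orthant \<Longrightarrow> \<rho> \<le> sum_norm u \<Longrightarrow>
      \<forall>i. g i u / sum_norm u < \<eta>"
    using eventually_sum_norm_to_infinity by blast
  define R where "R = max (\<rho> / \<sigma>) 1"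
  have R: "0 < R" "\<rho> \<le> \<sigma> * R"
    using \<sigma>_pos by (auto simp: R_def max_def field_simps)
  have "g j u \<le> \<eta> * (2 * R)" if "u \<in> shell (\<sigma> * R) (2 * R)" for j u
  proof -
    have u: "u \<in> punctured_orthant" "\<rho> \<le> sum_norm u" "sum_norm u \<le> 2 * R"
      using that R(2) by (auto simp: shell_def)
    have "g j u < \<eta> * sum_norm u"
      using \<rho>[OF u(1,2)] sum_norm_pos[OF u(1)] by (simp add: pos_divide_less_eq)
    also have "\<dots> \<le> \<eta> * (2 * R)"
      using u(3) \<eta>(1) by simp
    finally show ?thesis
      by simp
  qed
  moreover have "lam * (\<eta> * (2 * R)) * \<Gamma> \<le> (1 - \<theta>) * R"
    unfolding \<eta>(2)[symmetric] by (simp add: ac_simps)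
  ultimately show ?thesis
    using singular_solution[OF sing assms(2) R(1), of "\<eta> * (2 * R)"] by blast
qed

theorem solution_for_small_parameter:
  assumes sing: "filterlim (g i) at_top sum_norm_to_0" and "0 < \<rho>"
  obtains lam\<^sub>0 where "0 < lam\<^sub>0" "\<And>lam. 0 < lam \<Longrightarrow> lam < lam\<^sub>0 \<Longrightarrow>
    \<exists>x. positive_periodic_solution a b g \<omega> lam x \<and> sum_norm (x 0) \<le> \<rho>"
proof -
  obtain lam\<^sub>0 m where lam0: "0 < lam\<^sub>0" "\<And>j u. u \<in> shell (\<sigma> * \<rho>) (2 * \<rho>) \<Longrightarrow> g j u \<le> m"
    "\<And>lam. 0 < lam \<Longrightarrow> lam < lam\<^sub>0 \<Longrightarrow> lam * m * \<Gamma> \<le> (1 - \<theta>) * \<rho>"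
    using small_parameter[OF assms(2)] by metis
  have "\<exists>x. positive_periodic_solution a b g \<omega> lam x \<and> sum_norm (x 0) \<le> \<rho>"
    if "0 < lam" "lam < lam\<^sub>0" for lam
    using singular_solution[OF sing that(1) assms(2) lam0(3)[OF that] lam0(2)] by blast
  with lam0(1) that show ?thesis
    by blast
qed

theorem large_solution_if_superlinear:
  assumes sup: "filterlim (\<lambda>u. g i u / sum_norm u) at_top sum_norm_to_infinity" and "0 < \<rho>"
  obtains lam\<^sub>0 where "0 < lam\<^sub>0" "\<And>lam. 0 < lam \<Longrightarrow> lam < lam\<^sub>0 \<Longrightarrow>
    \<exists>x. positive_periodic_solution a b g \<omega> lam x \<and> \<rho> \<le> sum_norm (x 0)"
proof -
  obtain lam\<^sub>0 m where lam0: "0 < lam\<^sub>0" "\<And>j u. u \<in> shell (\<sigma> * \<rho>) (2 * \<rho>) \<Longrightarrow> g j u \<le> m"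
    "\<And>lam. 0 < lam \<Longrightarrow> lam < lam\<^sub>0 \<Longrightarrow> lam * m * \<Gamma> \<le> (1 - \<theta>) * \<rho>"
    using small_parameter[OF assms(2)] by metis
  have "\<exists>x. positive_periodic_solution a b g \<omega> lam x \<and> \<rho> \<le> sum_norm (x 0)"
    if lam: "0 < lam" "lam < lam\<^sub>0" for lam
  proof -
    define M where "M = 1 / (\<sigma>\<^sup>2 * lam * C i \<omega>)"
    have "0 < \<sigma>\<^sup>2 * lam * C i \<omega>"
      using lam(1) \<sigma>_pos C_period_pos by simp
    then have "0 < M" and M: "\<sigma>\<^sup>2 * (lam * M) * C i \<omega> = 1"
      by (auto simp: M_def)
    have "eventually (\<lambda>u. M \<le> g i u / sum_norm u) sum_norm_to_infinity"
      using sup by (simp add: filterlim_at_top)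
    then obtain \<rho>' where \<rho>': "\<And>u. u \<in> punctured_orthant \<Longrightarrow> \<rho>' \<le> sum_norm u \<Longrightarrow>
        M \<le> g i u / sum_norm u"
      using eventually_sum_norm_to_infinity by blast
    define R where "R = max (\<rho>' / \<sigma>) \<rho>"
    have R: "\<rho> \<le> R" "\<rho>' \<le> \<sigma> * R"
      using \<sigma>_pos by (auto simp: R_def max_def field_simps)
    obtain x where "positive_periodic_solution a b (\<lambda>i u. lam * g i u) \<omega> 1 x" "\<rho> \<le> sum_norm (x 0)"
    proof (rule periodic_system.expansion_solution[OF scaled_system[OF lam(1)],
          of \<rho> R "lam * M" i "lam * m"])
      fix u :: "real ^ 'n"
      assume u: "u \<in> punctured_orthant" "\<sigma> * R \<le> sum_norm u"
      then have "M \<le> g i u / sum_norm u"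
        using \<rho>' R(2) by simp
      then show "lam * M * sum_norm u \<le> lam * g i u"
        using sum_norm_pos[OF u(1)] lam(1) by (simp add: pos_le_divide_eq mult.assoc)
    qed (use lam assms(2) lam0 R(1) M \<open>0 < M\<close> in simp_all)
    then show ?thesis
      using scaled_solution by blast
  qed
  with lam0(1) that show ?thesis
    by blast
qed

end

theorem theorem1p1:
  fixes a b :: "'n::finite \<Rightarrow> real \<Rightarrow> real"
    and f :: "'n \<Rightarrow> real ^ 'n \<Rightarrow> real"
    and \<omega> :: real
  assumes "0 < \<omega>"
    and "\<And>i. continuous_on UNIV (a i)" and "\<And>i. continuous_on UNIV (b i)"
    and "\<And>i t. 0 \<le> a i t" and "\<And>i t. 0 \<le> b i t"
    and "\<And>i. periodic_fun_simple (a i) \<omega>" and "\<And>i. periodic_fun_simple (b i) \<omega>"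
    and "\<And>i. 0 < integral {0..\<omega>} (a i)" and "\<And>i. 0 < integral {0..\<omega>} (b i)"
    and "\<And>i. continuous_on punctured_orthant (f i)"
    and "\<And>i u. u \<in> punctured_orthant \<Longrightarrow> 0 < f i u"
    and "\<exists>i. filterlim (f i) at_top sum_norm_to_0"
  shows
    "((\<forall>i. ((\<lambda>u. f i u / sum_norm u) \<longlongrightarrow> 0) sum_norm_to_infinity) \<longrightarrow>
        (\<forall>lam>0. \<exists>x. positive_periodic_solution a b f \<omega> lam x)) \<and>
     ((\<forall>i. filterlim (\<lambda>u. f i u / sum_norm u) at_top sum_norm_to_infinity) \<longrightarrow>
        (\<exists>lam0>0. \<forall>lam. 0 < lam \<and> lam < lam0 \<longrightarrow>
           (\<exists>x y. x \<noteq> y \<and> positive_periodic_solution a b f \<omega> lam x \<and>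
                  positive_periodic_solution a b f \<omega> lam y))) \<and>
     (\<exists>lam0>0. \<forall>lam. 0 < lam \<and> lam < lam0 \<longrightarrow>
        (\<exists>x. positive_periodic_solution a b f \<omega> lam x))"
proof -
  interpret periodic_system a b \<omega> f
    by (intro periodic_system.intro periodic_coefficients.intro periodic_system_axioms.intro assms)
  obtain i where sing: "filterlim (f i) at_top sum_norm_to_0"
    using assms(12) by blast
  obtain lam\<^sub>1 where lam1: "0 < lam\<^sub>1" "\<And>lam. 0 < lam \<Longrightarrow> lam < lam\<^sub>1 \<Longrightarrow>
      \<exists>x. positive_periodic_solution a b f \<omega> lam x \<and> sum_norm (x 0) \<le> 1"
    using solution_for_small_parameter[OF sing zero_less_one] by blast
  have two: "\<exists>lam0>0. \<forall>lam. 0 < lam \<and> lam < lam0 \<longrightarrow>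
      (\<exists>x y. x \<noteq> y \<and> positive_periodic_solution a b f \<omega> lam x \<and>
        positive_periodic_solution a b f \<omega> lam y)"
    if sup: "\<forall>i. filterlim (\<lambda>u. f i u / sum_norm u) at_top sum_norm_to_infinity"
  proof -
    obtain lam\<^sub>2 where lam2: "0 < lam\<^sub>2" "\<And>lam. 0 < lam \<Longrightarrow> lam < lam\<^sub>2 \<Longrightarrow>
        \<exists>x. positive_periodic_solution a b f \<omega> lam x \<and> 2 \<le> sum_norm (x 0)"
      using large_solution_if_superlinear[OF spec[OF sup] zero_less_numeral] by blast
    have "\<exists>x y. x \<noteq> y \<and> positive_periodic_solution a b f \<omega> lam x \<and>
        positive_periodic_solution a b f \<omega> lam y" if lam: "0 < lam" "lam < min lam\<^sub>1 lam\<^sub>2" for lam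
    proof -
      obtain x where x: "positive_periodic_solution a b f \<omega> lam x" "sum_norm (x 0) \<le> 1"
        using lam1(2)[of lam] lam by auto
      obtain y where y: "positive_periodic_solution a b f \<omega> lam y" "2 \<le> sum_norm (y 0)"
        using lam2(2)[of lam] lam by auto
      have "x \<noteq> y"
        using x(2) y(2) by auto
      with x(1) y(1) show ?thesis
        by blast
    qed
    then show ?thesis
      using lam1(1) lam2(1) by (intro exI[of _ "min lam\<^sub>1 lam\<^sub>2"]) simp
  qed
  show ?thesis
  proof (intro conjI impI allI)
    fix lam :: real
    assume "\<forall>i. ((\<lambda>u. f i u / sum_norm u) \<longlongrightarrow> 0) sum_norm_to_infinity" "0 < lam"
    then show "\<exists>x. positive_periodic_solution a b f \<omega> lam x"
      using solution_if_sublinear[OF sing] by simp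
  next
    show "\<exists>lam0>0. \<forall>lam. 0 < lam \<and> lam < lam0 \<longrightarrow> (\<exists>x. positive_periodic_solution a b f \<omega> lam x)"
      using lam1 by (intro exI[of _ lam\<^sub>1]) metis
  qed (rule two)
qed

end
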